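(* Let $\emptyset\neq G\subset\mathbb{R}^n$ be an open set, $0<\varepsilon,s<1$ and $1<p<\infty$. Fix $L\ge 0$ and an $L$-Lipschitz function $R:G\to\mathbb{R}$ satisfying $0\le R(x)\le\operatorname{dist}(x,\partial G)$ for every $x\in G$. Then there exists a constant $C=C(n,p,\varepsilon)>0$, depending only on $n$, $p$ and $\varepsilon$, such that $$|M_R(f)|_{W^{s,p}(G)}\le C(1+L)^{\varepsilon/p+s}\,|f|_{W^{s,p}(G)}$$ holds for every function $f\in L^p(G)$.
   Context: Convention: $\operatorname{dist}(x,\partial G)=\infty$ if $x\in G=\mathbb{R}^n$. $R$ is $L$-Lipschitz on $G$ if $|R(x)-R(y)|\le L|x-y|$ for all $x,y\in G$. $B(x,r)$ is the open ball of center $x$ and radius $r$. For $f\in L^1_{\mathrm{loc}}(G)$ and $x\in G$, $$M_R(f)(x)=\sup_{0\le r\le R(x)}\frac{1}{|B(x,r)|}\int_{B(x,r)}|f(y)|\,dy,$$ where for $r=0$ the average is by convention equal to $|f(x)|$. The fractional Sobolev seminorm is $$|f|_{W^{s,p}(G)}=\Big(\int_G\int_G\frac{|f(x)-f(y)|^p}{|x-y|^{n+sp}}\,dy\,dx\Big)^{1/p}.$$ *)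

theory Defs
  imports "HOL-Analysis.Analysis"
begin

text \<open>Real powers with positive exponent on \<open>[0,\<infinity>]\<close>, with \<open>\<infinity> ^ a = \<infinity>\<close>.\<close>

definition ennpowr :: "ennreal \<Rightarrow> real \<Rightarrow> ennreal" where
  "ennpowr x a = (if x = \<infinity> then \<infinity> else ennreal (enn2real x powr a))"

text \<open>The case distinction is needed because \<^term>\<open>infdist x {} = 0\<close>.\<close>

definition bdist :: "'a::metric_space set \<Rightarrow> 'a \<Rightarrow> ereal" where
  "bdist G x = (if G = UNIV then \<infinity> else ereal (infdist x (frontier G)))"

definition ball_avg :: "('a::euclidean_space \<Rightarrow> real) \<Rightarrow> 'a \<Rightarrow> real \<Rightarrow> ennreal" where
  "ball_avg f x r =
     (if r = 0 then ennreal \<bar>f x\<bar>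
      else (\<integral>\<^sup>+y\<in>ball x r. ennreal \<bar>f y\<bar> \<partial>lebesgue) / emeasure lebesgue (ball x r))"

text \<open>The supremum is taken in \<open>[0,\<infinity>]\<close>, as it may be infinite at some points. For an
  open set \<open>G\<close>, \<open>x \<in> G\<close> and \<open>R x\<close> at most the distance to the boundary, all balls involved lie
  in \<open>G\<close>, so the values of \<open>f\<close> outside \<open>G\<close> are irrelevant.\<close>

definition maximal_fun ::
    "('a::euclidean_space \<Rightarrow> real) \<Rightarrow> ('a \<Rightarrow> real) \<Rightarrow> 'a \<Rightarrow> ennreal" where
  "maximal_fun R f x = (SUP r\<in>{0..R x}. ball_avg f x r)"

definition in_Lp :: "real \<Rightarrow> 'a::euclidean_space set \<Rightarrow> ('a \<Rightarrow> real) \<Rightarrow> bool" where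
  "in_Lp p G f \<longleftrightarrow> f \<in> borel_measurable (lebesgue_on G) \<and>
     integrable (lebesgue_on G) (\<lambda>x. \<bar>f x\<bar> powr p)"

text \<open>The seminorm takes extended real valued functions, so that it applies to maximal
  functions, and has its values in \<open>[0,\<infinity>]\<close>. On \<^typ>\<open>ereal\<close> we have \<open>\<bar>\<infinity> - \<infinity>\<bar> = \<infinity>\<close>; this
  convention has no effect for functions that are finite almost everywhere.\<close>

definition frac_sobolev_seminorm ::
    "real \<Rightarrow> real \<Rightarrow> 'a::euclidean_space set \<Rightarrow> ('a \<Rightarrow> ereal) \<Rightarrow> ennreal" where
  "frac_sobolev_seminorm s p G u =
     ennpowr (\<integral>\<^sup>+x\<in>G. (\<integral>\<^sup>+y\<in>G.
         ennpowr (e2ennreal \<bar>u x - u y\<bar>) p / ennreal (norm (x - y) powr (real DIM('a) + s * p))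
       \<partial>lebesgue) \<partial>lebesgue) (1 / p)"

end

theory Submission
  imports Defs
begin

text \<open>
  Let \<open>g = \<bar>f\<bar>\<close>, \<open>l = 1 + L\<close> and \<open>d = dist x y\<close>. As \<open>R y \<ge> R x - L * d\<close>, it suffices to bound the excess
  of the average of \<open>g\<close> over \<open>ball x r\<close> over \<open>g y\<close> or over the average on \<open>ball y (r - l * d)\<close>, whichever
  is convenient.
  For \<open>r \<le> d\<close> the excess over \<open>g y\<close> is controlled by the Hardy--Littlewood maximal function of the
  difference quotient \<open>w \<mapsto> \<bar>g w - g y\<bar> / \<bar>w - y\<bar> ^ (n / p + s)\<close>.
  For \<open>d \<le> r \<le> 2 * l * d\<close>, Jensen's inequality and
  \<open>r ^ (- n) \<le> (\<bar>w - y\<bar> / 2) ^ (\<epsilon> - n) * d ^ (- \<epsilon>)\<close> give a bound free of the supremum over \<open>r\<close>; this is the only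
  step that costs \<open>l ^ \<epsilon>\<close>, and it is what keeps the constant uniform as \<open>s\<close> tends to \<open>0\<close>.
  For larger \<open>r\<close>, shrinking the radius by \<open>l * d\<close> and then moving the center costs maximal functions of the
  translation differences \<open>z \<mapsto> \<bar>g z - g (z + w)\<bar>\<close> with \<open>\<bar>w\<bar> < 2 * l * d\<close>.
  After integration against \<open>\<bar>x - y\<bar> ^ (- n - s * p)\<close>, each term reduces to the seminorm of \<open>f\<close> by Fubini's theorem and
  the boundedness of the maximal operator on \<open>L\<^sup>p\<close>. All these estimates are monotone, so the
  measurability of the local maximal function is never needed.
\<close>

subsection \<open>Powers of extended nonnegative reals\<close>

text \<open>The constant may not depend on s, yet for small s integrating
  \<open>|x-y|^(-n-s*p)\<close> over \<open>|x-y| >= a\<close> produces a factor of order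
  \<open>1/(s*p)\<close>. So every integral over such a tail is arranged to carry additional decay:
  \<open>|x-y|^(-\<epsilon>)\<close> in the intermediate range, and \<open>|x-y|^(-n)\<close> for
  large radii, coming from the normalisation of an average over shifts in a ball of radius
  \<open>2*l*|x-y|\<close>. In the latter case the volume factor l^n cancels and only l^(s*p) is
  left. As s tends to 1 nothing degenerates, since s enters the constants only through powers such
  as \<open>2^(s*p) <= 2^p\<close>. The intermediate range is the obstacle: the ratio of its end
  radii is of order l, and stretching the difference quotient estimate up to
  \<open>2*l*|x-y|\<close> would cost l^(n+s*p) in the p-th power. The weight reduces this to
  l^(\<epsilon>+s*p), whose p-th root is the claimed (1+L)^(\<epsilon>/p+s). The pointwise bound is
  one-sided, so the roles of x and y are interchanged at the end.\<close>

lemma ennpowr_top [simp]: "ennpowr top p = top"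
  by (simp add: ennpowr_def)

lemma ennpowr_0 [simp]: "ennpowr 0 p = 0"
  by (simp add: ennpowr_def)

lemma ennpowr_ennreal: "0 \<le> a \<Longrightarrow> ennpowr (ennreal a) p = ennreal (a powr p)"
  by (simp add: ennpowr_def)

lemma ennpowr_mono:
  assumes "0 \<le> p" "x \<le> y" shows "ennpowr x p \<le> ennpowr y p"
  using assms
  by (cases x; cases y) (auto simp: ennpowr_ennreal top_unique intro!: ennreal_leI powr_mono2)

lemma ennpowr_mult: "ennpowr (x * y) p = ennpowr x p * ennpowr y p"
proof (cases "x = 0 \<or> y = 0")
  case False
  then show ?thesis
  proof (cases x; cases y)
    fix a b assume "x = ennreal a" "0 \<le> a" "y = ennreal b" "0 \<le> b"
    then show ?thesis
      by (simp add: ennpowr_ennreal powr_mult flip: ennreal_mult)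
  qed (use False in \<open>auto simp: ennpowr_ennreal ennreal_mult_top ennreal_top_mult\<close>)
qed auto

lemma ennpowr_powr: "ennpowr (ennpowr x p) q = ennpowr x (p * q)"
  by (cases x) (auto simp: ennpowr_ennreal powr_powr)

lemma ennpowr_1 [simp]: "ennpowr x 1 = x"
  by (cases x) (auto simp: ennpowr_ennreal)

lemma measurable_ennpowr [measurable]: "(\<lambda>x. ennpowr x p) \<in> borel_measurable borel"
  unfolding ennpowr_def by measurable

lemma ennpowr_add_le:
  assumes "0 \<le> p"
  shows "ennpowr (x + y) p \<le> ennreal (2 powr p) * (ennpowr x p + ennpowr y p)"
proof -
  have "x + y \<le> 2 * max x y"
    by (metis add_mono max.cobounded1 max.cobounded2 mult_2)
  then have "ennpowr (x + y) p \<le> ennpowr (2 * max x y) p"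
    by (rule ennpowr_mono[OF assms])
  also have "\<dots> = ennreal (2 powr p) * ennpowr (max x y) p"
    using ennpowr_ennreal[of 2 p] by (simp add: ennpowr_mult)
  also have "ennpowr (max x y) p \<le> ennpowr x p + ennpowr y p"
    by (simp add: max_def add_increasing add_increasing2)
  finally show ?thesis
    by (simp add: mult_left_mono)
qed

text \<open>Whether h is below or above m, h <= m + m^(1-p) * h^p. With j the mean of h^p, averaging
  gives at most 2m for every m > j^(1/p), and m then decreases to j^(1/p). This is Jensen's
  inequality up to the factor 2^p, for values in [0,\<infinity>].\<close>

lemma ennpowr_average_le:
  assumes p: "1 < p" and [measurable]: "h \<in> borel_measurable M" "S \<in> sets M"
    and S: "emeasure M S \<noteq> 0" "emeasure M S \<noteq> top"
  shows "ennpowr ((\<integral>\<^sup>+x\<in>S. h x \<partial>M) / emeasure M S) p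
    \<le> ennreal (2 powr p) * ((\<integral>\<^sup>+x\<in>S. ennpowr (h x) p \<partial>M) / emeasure M S)"
proof (cases "(\<integral>\<^sup>+x\<in>S. ennpowr (h x) p \<partial>M) / emeasure M S" rule: ennreal_cases)
  case top
  then show ?thesis by (simp add: ennreal_mult_top)
next
  case (real j)
  let ?a = "emeasure M S"
  \<comment> \<open>The strict inequality keeps m positive even when j = 0.\<close>
  have bound: "(\<integral>\<^sup>+x\<in>S. h x \<partial>M) / ?a \<le> ennreal (2 * m)" if m: "j powr (1/p) < m" for m
  proof -
    have m0: "0 < m" using m by (smt (verit) powr_ge_zero)
    have jm: "j \<le> m powr p"
    proof -
      have "j = (j powr (1/p)) powr p" using p real by (simp add: powr_powr)
      also have "\<dots> \<le> m powr p" using m p by (intro powr_mono2) auto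
      finally show ?thesis .
    qed
    \<comment> \<open>an elementary substitute for Young's inequality\<close>
    have "h x \<le> ennreal m + ennreal (m powr (1 - p)) * ennpowr (h x) p" for x
    proof (cases "h x")
      case (real t)
      show ?thesis
      proof (cases "t \<le> m")
        case True
        then show ?thesis using real by (simp add: add_increasing2 ennreal_leI)
      next
        case False
        have "t = t powr (1 - p) * t powr p"
          using False m0 by (simp flip: powr_add)
        also have "\<dots> \<le> m powr (1 - p) * t powr p"
          using False m0 p by (intro mult_right_mono powr_mono2') auto
        finally have "ennreal t \<le> ennreal (m powr (1 - p)) * ennpowr (h x) p"
          using real by (simp add: ennpowr_ennreal ennreal_leI flip: ennreal_mult)
        then show ?thesis using real by (simp add: add_increasing)
      qed
    qed (use m0 in \<open>simp add: ennreal_mult_top\<close>)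
    then have "(\<integral>\<^sup>+x\<in>S. h x \<partial>M)
        \<le> (\<integral>\<^sup>+x. ennreal m * indicator S x + ennreal (m powr (1 - p)) * (ennpowr (h x) p * indicator S x) \<partial>M)"
      by (intro nn_integral_mono) (auto split: split_indicator)
    also have "\<dots> = ennreal m * ?a + ennreal (m powr (1 - p)) * (\<integral>\<^sup>+x\<in>S. ennpowr (h x) p \<partial>M)"
      by (simp add: nn_integral_add nn_integral_cmult)
    finally have "(\<integral>\<^sup>+x\<in>S. h x \<partial>M) / ?a
        \<le> (ennreal m * ?a + ennreal (m powr (1 - p)) * (\<integral>\<^sup>+x\<in>S. ennpowr (h x) p \<partial>M)) / ?a"
      by (rule divide_right_mono_ennreal)
    also have "\<dots> = ennreal m * (?a / ?a) + ennreal (m powr (1 - p)) * ennreal j"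
      by (simp only: add_divide_distrib_ennreal real(2) flip: ennreal_times_divide)
    also have "\<dots> = ennreal (m + m powr (1 - p) * j)"
      using S m0 real(1) by (simp add: ennreal_mult top.not_eq_extremum)
    also have "\<dots> \<le> ennreal (2 * m)"
    proof (rule ennreal_leI)
      have "m powr (1 - p) * j \<le> m powr (1 - p) * m powr p"
        using jm by (intro mult_left_mono) auto
      also have "\<dots> = m" using m0 by (simp flip: powr_add)
      finally show "m + m powr (1 - p) * j \<le> 2 * m" by simp
    qed
    finally show ?thesis .
  qed
  have "(\<integral>\<^sup>+x\<in>S. h x \<partial>M) / ?a \<le> ennreal (2 * j powr (1/p))"
  proof (rule ennreal_le_epsilon)
    fix e :: real assume "0 < e"
    with bound[of "j powr (1/p) + e/2"]
    show "(\<integral>\<^sup>+x\<in>S. h x \<partial>M) / ?a \<le> ennreal (2 * j powr (1/p)) + ennreal e"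
      by (simp add: distrib_left flip: ennreal_plus)
  qed
  then have "ennpowr ((\<integral>\<^sup>+x\<in>S. h x \<partial>M) / ?a) p \<le> ennpowr (ennreal (2 * j powr (1/p))) p"
    using p by (intro ennpowr_mono) auto
  also have "\<dots> = ennreal (2 powr p) * ennreal j"
    using p real(1) by (simp add: ennpowr_ennreal powr_mult powr_powr flip: ennreal_mult)
  finally show ?thesis using real by simp
qed

subsection \<open>The Hardy--Littlewood maximal function\<close>

definition havg :: "('a::euclidean_space \<Rightarrow> ennreal) \<Rightarrow> 'a \<Rightarrow> real \<Rightarrow> ennreal" where
  "havg h x r = (\<integral>\<^sup>+z\<in>ball x r. h z \<partial>lborel) / emeasure lborel (ball x r)"

text \<open>Restricting to dyadic radii makes the supremum countable, hence jointly measurable when \<open>h\<close> depends on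
  parameters; it loses only a factor \<open>2 ^ n\<close>.\<close>

definition hlmax :: "('a::euclidean_space \<Rightarrow> ennreal) \<Rightarrow> 'a \<Rightarrow> ennreal" where
  "hlmax h x = (SUP k::int. havg h x (2 powi k))"

lemma emeasure_ball_pos:
  assumes "0 < r" shows "emeasure lborel (ball (x::'a::euclidean_space) r) \<noteq> 0"
    "emeasure lborel (ball (x::'a::euclidean_space) r) \<noteq> top"
  using assms by (simp_all add: emeasure_ball less_imp_neq[symmetric])

lemma havg_times:
  assumes "0 < r"
  shows "havg h x r * emeasure lborel (ball x r) = (\<integral>\<^sup>+z\<in>ball x r. h z \<partial>lborel)"
  unfolding havg_def using emeasure_ball_pos[OF assms, of x]
  by (simp add: ennreal_divide_times less_top)

lemma emeasure_ball_scale: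
  assumes "0 \<le> r" "0 \<le> c"
  shows "emeasure lborel (ball (x::'a::euclidean_space) (c * r))
    = ennreal (c ^ DIM('a)) * emeasure lborel (ball (y::'a) r)"
  using assms by (simp add: emeasure_ball power_mult_distrib mult_ac flip: ennreal_mult)

text \<open>Center and radius both vary with the parameter, so membership in the ball is rewritten
  as an inequality between measurable functions and the volume as a power of the radius;
  \<open>max 0\<close> covers negative radii, whose balls are empty.\<close>

lemma measurable_havg_pair:
  fixes h :: "'b \<Rightarrow> 'a::euclidean_space \<Rightarrow> ennreal"
  assumes [measurable]: "(\<lambda>(w, z). h w z) \<in> borel_measurable (M \<Otimes>\<^sub>M borel)"
    and [measurable]: "X \<in> borel_measurable M" "r \<in> borel_measurable M"
  shows "(\<lambda>w. havg (h w) (X w) (r w)) \<in> borel_measurable M"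
proof -
  have "havg (h w) (X w) (r w) = (\<integral>\<^sup>+z. h w z * (if dist (X w) z < r w then 1 else 0) \<partial>lborel)
      / ennreal (unit_ball_vol DIM('a) * max 0 (r w) ^ DIM('a))" for w
  proof -
    have "emeasure lborel (ball (X w) (r w)) = ennreal (unit_ball_vol DIM('a) * max 0 (r w) ^ DIM('a))"
      by (cases "0 \<le> r w") (simp_all add: emeasure_ball ball_empty max_def)
    moreover have "(\<integral>\<^sup>+z\<in>ball (X w) (r w). h w z \<partial>lborel)
      = (\<integral>\<^sup>+z. h w z * (if dist (X w) z < r w then 1 else 0) \<partial>lborel)"
      by (intro nn_integral_cong) (simp add: indicator_def)
    ultimately show ?thesis by (simp only: havg_def)
  qed
  moreover have "(\<lambda>w. (\<integral>\<^sup>+z. h w z * (if dist (X w) z < r w then 1 else 0) \<partial>lborel)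
      / ennreal (unit_ball_vol DIM('a) * max 0 (r w) ^ DIM('a))) \<in> borel_measurable M"
    by measurable
  ultimately show ?thesis by (simp only:)
qed

lemma measurable_hlmax_pair:
  fixes h :: "'b \<Rightarrow> 'a::euclidean_space \<Rightarrow> ennreal"
  assumes [measurable]: "(\<lambda>(w, z). h w z) \<in> borel_measurable (M \<Otimes>\<^sub>M borel)"
    and [measurable]: "X \<in> borel_measurable M"
  shows "(\<lambda>w. hlmax (h w) (X w)) \<in> borel_measurable M"
  unfolding hlmax_def by (intro borel_measurable_SUP measurable_havg_pair assms) auto

lemma measurable_hlmax:
  assumes [measurable]: "h \<in> borel_measurable borel"
  shows "hlmax h \<in> borel_measurable borel"
  by (rule measurable_hlmax_pair[where X = "\<lambda>x. x" and h = "\<lambda>_. h"]) measurable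

lemma havg_le_hlmax:
  fixes h :: "'a::euclidean_space \<Rightarrow> ennreal"
  assumes "0 < r"
  shows "havg h x r \<le> ennreal (2 ^ DIM('a)) * hlmax h x"
proof -
  \<comment> \<open>The least dyadic radius not below r; it is at most 2r, which costs the volume
    ratio 2^n.\<close>
  define k where "k = \<lceil>log 2 r\<rceil>"
  have k: "r \<le> 2 powi k" "2 powi k \<le> 2 * r"
  proof -
    have e: "(2::real) powi k = 2 powr k" by (simp add: powr_real_of_int')
    have "log 2 r \<le> k" "k \<le> log 2 r + 1" unfolding k_def by linarith+
    then have "2 powr (log 2 r) \<le> 2 powr k" "2 powr k \<le> 2 powr (log 2 r + 1)"
      by (auto intro!: powr_mono)
    then show "r \<le> 2 powi k" "2 powi k \<le> 2 * r"
      unfolding e using assms by (simp_all add: powr_add)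
  qed
  let ?I = "\<integral>\<^sup>+z\<in>ball x (2 powi k). h z \<partial>lborel"
  have "emeasure lborel (ball x (2 powi k)) \<le> emeasure lborel (ball x (2 * r))"
    using k by (intro emeasure_mono subset_ball) auto
  also have "\<dots> = ennreal (2 ^ DIM('a)) * emeasure lborel (ball x r)"
    using assms by (intro emeasure_ball_scale) auto
  finally have m: "emeasure lborel (ball x (2 powi k)) \<le> ennreal (2 ^ DIM('a)) * emeasure lborel (ball x r)" .
  have "(\<integral>\<^sup>+z\<in>ball x r. h z \<partial>lborel) \<le> ?I"
    using k by (intro nn_integral_mono) (auto split: split_indicator)
  also have "?I = havg h x (2 powi k) * emeasure lborel (ball x (2 powi k))"
    by (simp add: havg_times)
  also have "\<dots> \<le> hlmax h x * (ennreal (2 ^ DIM('a)) * emeasure lborel (ball x r))"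
    using m unfolding hlmax_def by (intro mult_mono SUP_upper) auto
  finally show ?thesis
    unfolding havg_def using emeasure_ball_pos[OF assms, of x]
    by (intro divide_le_posI_ennreal) (auto simp: mult_ac zero_less_iff_neq_zero)
qed

text \<open>The indicator of the union is at most the number of sets containing the point; integrate
  and exchange. Integration over \<open>count_space\<close> replaces a series because the covering
  lemma supplies a countable index set, not a sequence.\<close>

lemma emeasure_UN_le_nn_integral:
  assumes "countable C" and [measurable]: "\<And>i. i \<in> C \<Longrightarrow> A i \<in> sets M"
  shows "emeasure M (\<Union>i\<in>C. A i) \<le> (\<integral>\<^sup>+i. emeasure M (A i) \<partial>count_space C)"
proof -
  have [measurable]: "(\<Union>i\<in>C. A i) \<in> sets M"
    using assms by (intro sets.countable_UN') auto
  have "emeasure M (\<Union>i\<in>C. A i) = (\<integral>\<^sup>+x. indicator (\<Union>i\<in>C. A i) x \<partial>M)"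
    by simp
  also have "\<dots> \<le> (\<integral>\<^sup>+x. \<integral>\<^sup>+i. indicator (A i) x \<partial>count_space C \<partial>M)"
  proof (rule nn_integral_mono)
    fix x show "indicator (\<Union>i\<in>C. A i) x \<le> (\<integral>\<^sup>+i. indicator (A i) x \<partial>count_space C :: ennreal)"
    proof (cases "x \<in> (\<Union>i\<in>C. A i)")
      case True
      then obtain i where "i \<in> C" "x \<in> A i" by auto
      then show ?thesis
        using nn_integral_ge_point[of i C "\<lambda>i. indicator (A i) x"] True by simp
    qed simp
  qed
  also have "\<dots> = (\<integral>\<^sup>+i. \<integral>\<^sup>+x. indicator (A i) x \<partial>M \<partial>count_space C)"
    using assms by (intro nn_integral_count_space_nn_integral) auto
  also have "\<dots> = (\<integral>\<^sup>+i. emeasure M (A i) \<partial>count_space C)"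
    by (intro nn_integral_cong) auto
  finally show ?thesis .
qed

text \<open>Vitali's covering argument: balls on which h has mean above t cover the superlevel set,
  a disjoint subfamily enlarged five times still covers it, and disjointness bounds its total volume
  by the integral of h divided by t.\<close>

lemma hlmax_weak_type:
  fixes h :: "'a::euclidean_space \<Rightarrow> ennreal"
  assumes [measurable]: "h \<in> borel_measurable borel" and "0 < t"
  shows "ennreal t * emeasure lborel {x. ennreal t < hlmax h x} \<le> ennreal (5 ^ DIM('a)) * (\<integral>\<^sup>+x. h x \<partial>lborel)"
proof (cases "\<integral>\<^sup>+x. h x \<partial>lborel" rule: ennreal_cases)
  case top
  then show ?thesis by (simp add: ennreal_mult_top)
next
  case (real I)
  let ?n = "DIM('a)"
  have [measurable]: "hlmax h \<in> borel_measurable borel" by (rule measurable_hlmax) fact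
  \<comment> \<open>One center may occur with several dyadic radii, hence pairs as indices.\<close>
  define K where "K = {(x, k::int). ennreal t < havg h x (2 powi k)}"
  define rad where "rad i = (2::real) powi (snd i)" for i :: "'a \<times> int"
  have radpos: "0 < rad i" for i by (simp add: rad_def)
  have ball_le: "ennreal t * emeasure lborel (ball (fst i) (rad i)) \<le> (\<integral>\<^sup>+z\<in>ball (fst i) (rad i). h z \<partial>lborel)"
    if "i \<in> K" for i
  proof -
    have "ennreal t \<le> havg h (fst i) (rad i)" using that by (auto simp: K_def rad_def)
    then have "ennreal t * emeasure lborel (ball (fst i) (rad i)) \<le> havg h (fst i) (rad i) * emeasure lborel (ball (fst i) (rad i))"
      by (intro mult_right_mono) auto
    also have "\<dots> = (\<integral>\<^sup>+z\<in>ball (fst i) (rad i). h z \<partial>lborel)"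
      by (simp add: havg_times radpos)
    finally show ?thesis .
  qed
  \<comment> \<open>The covering lemma needs bounded radii. Mean above t forces
    \<open>rad i ^ n <= I / (t * unit_ball_vol n)\<close>, and a radius above 1 is at most its n-th
    power.\<close>
  define B where "B = max 1 (I / (t * unit_ball_vol ?n))"
  have rad_le: "rad i \<le> B" if "i \<in> K" for i
  proof (cases "rad i \<le> 1")
    case False
    have "ennreal t * emeasure lborel (ball (fst i) (rad i)) \<le> (\<integral>\<^sup>+z. h z \<partial>lborel)"
      using ball_le[OF that] by (rule order_trans) (auto intro!: nn_integral_mono split: split_indicator)
    then have "t * (unit_ball_vol ?n * rad i ^ ?n) \<le> I"
      using \<open>0 < t\<close> radpos[of i] real by (simp add: emeasure_ball flip: ennreal_mult)
    then have "rad i ^ ?n \<le> I / (t * unit_ball_vol ?n)"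
      using \<open>0 < t\<close> by (simp add: field_simps)
    moreover have "rad i \<le> rad i ^ ?n" using False by (intro self_le_power) auto
    ultimately show ?thesis unfolding B_def by linarith
  qed (simp add: B_def)
  have "{x. ennreal t < hlmax h x} \<subseteq> (\<Union>i\<in>K. ball (fst i) (rad i))"
  proof
    fix x assume "x \<in> {x. ennreal t < hlmax h x}"
    then obtain k where "ennreal t < havg h x (2 powi k)"
      by (auto simp: hlmax_def less_SUP_iff)
    then have "(x, k) \<in> K" by (simp add: K_def)
    then show "x \<in> (\<Union>i\<in>K. ball (fst i) (rad i))" using radpos[of "(x, k)"] by force
  qed
  moreover have "\<And>i. i \<in> K \<Longrightarrow> 0 < rad i \<and> rad i \<le> B" using radpos rad_le by auto
  ultimately obtain C where C: "countable C" "C \<subseteq> K"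
     "pairwise (\<lambda>i j. disjnt (ball (fst i) (rad i)) (ball (fst j) (rad j))) C"
     "{x. ennreal t < hlmax h x} \<subseteq> (\<Union>i\<in>C. ball (fst i) (5 * rad i))"
    by (rule Vitali_covering_lemma_balls)
  have disj: "disjoint_family_on (\<lambda>i. ball (fst i) (rad i)) C"
    using C(3) by (auto simp: disjoint_family_on_def pairwise_def disjnt_def)
  have scale: "emeasure lborel (ball a (5 * rad i)) = ennreal (5 ^ ?n) * emeasure lborel (ball a (rad i))" for a :: 'a and i
    using radpos[of i] by (intro emeasure_ball_scale) auto
  have "ennreal t * emeasure lborel {x. ennreal t < hlmax h x} \<le> ennreal t * emeasure lborel (\<Union>i\<in>C. ball (fst i) (5 * rad i))"
    using C by (intro mult_left_mono emeasure_mono) auto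
  also have "emeasure lborel (\<Union>i\<in>C. ball (fst i) (5 * rad i)) \<le> (\<integral>\<^sup>+i. emeasure lborel (ball (fst i) (5 * rad i)) \<partial>count_space C)"
    using C by (intro emeasure_UN_le_nn_integral) auto
  also have "ennreal t * (\<integral>\<^sup>+i. emeasure lborel (ball (fst i) (5 * rad i)) \<partial>count_space C)
     = (\<integral>\<^sup>+i. ennreal (5 ^ ?n) * (ennreal t * emeasure lborel (ball (fst i) (rad i))) \<partial>count_space C)"
    by (subst nn_integral_cmult[symmetric])
       (auto intro!: nn_integral_cong simp: scale mult_ac)
  also have "\<dots> \<le> (\<integral>\<^sup>+i. ennreal (5 ^ ?n) * (\<integral>\<^sup>+z\<in>ball (fst i) (rad i). h z \<partial>lborel) \<partial>count_space C)"
    using C by (intro nn_integral_mono mult_left_mono ball_le) auto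
  \<comment> \<open>Reading the integrals as values of the measure with density h turns their sum
    over disjoint balls into the measure of one union.\<close>
  also have "\<dots> = ennreal (5 ^ ?n) * (\<integral>\<^sup>+i. emeasure (density lborel h) (ball (fst i) (rad i)) \<partial>count_space C)"
    by (subst nn_integral_cmult) (auto intro!: arg_cong2[where f="(*)"] nn_integral_cong simp: emeasure_density)
  also have "(\<integral>\<^sup>+i. emeasure (density lborel h) (ball (fst i) (rad i)) \<partial>count_space C)
      = emeasure (density lborel h) (\<Union>i\<in>C. ball (fst i) (rad i))"
    using C disj by (intro emeasure_UN_countable[symmetric]) auto
  also have "\<dots> \<le> emeasure (density lborel h) UNIV"
    by (intro emeasure_mono) auto
  also have "\<dots> = (\<integral>\<^sup>+x. h x \<partial>lborel)"
    by (simp add: emeasure_density)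
  finally show ?thesis by (simp add: mult_left_mono)
qed

section \<open>Layer cake formula and interpolation to the strong type bound\<close>

lemma nn_integral_powr_below:
  assumes "-1 < q" "0 \<le> a"
  shows "(\<integral>\<^sup>+t. ennreal (t powr q) * indicator {0<..<a} t \<partial>lborel) = ennreal (a powr (q + 1) / (q + 1))"
proof -
  have "(\<integral>\<^sup>+t. ennreal (t powr q) * indicator {0<..<a} t \<partial>lborel)
      = (\<integral>\<^sup>+t. ennreal (t powr q) * indicator {0..a} t \<partial>lborel)"
  proof (rule nn_integral_cong_AE)
    show "AE t in lborel. ennreal (t powr q) * indicator {0<..<a} t = ennreal (t powr q) * indicator {0..a} t"
      using AE_lborel_singleton[of "0::real"] AE_lborel_singleton[of a]
      by eventually_elim (auto simp: indicator_def)
  qed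
  also have "\<dots> = ennreal (a powr (q + 1) / (q + 1))"
    by (rule nn_integral_has_integral_lebesgue'[OF _ has_integral_powr_from_0[OF assms]]) auto
  finally show ?thesis .
qed

lemma ennpowr_le_layer_cake:
  assumes "0 < p"
  shows "ennpowr m p \<le> (\<integral>\<^sup>+t. ennreal (p * t powr (p - 1)) * indicator {t. 0 < t \<and> ennreal t < m} t \<partial>lborel)"
    (is "_ \<le> ?I m")
proof -
  have lower: "ennreal (a powr p) \<le> ?I m" if "0 \<le> a" "ennreal a \<le> m" for a
  proof -
    have "ennreal (a powr p) = ennreal p * ennreal (a powr p / p)"
      using assms by (simp flip: ennreal_mult)
    also have "ennreal (a powr p / p) = (\<integral>\<^sup>+t. ennreal (t powr (p - 1)) * indicator {0<..<a} t \<partial>lborel)"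
      using nn_integral_powr_below[of "p - 1" a] assms that by simp
    also have "ennreal p * \<dots> = (\<integral>\<^sup>+t. ennreal (p * t powr (p - 1)) * indicator {0<..<a} t \<partial>lborel)"
      using assms by (subst nn_integral_cmult[symmetric]) (auto simp: ennreal_mult mult.assoc)
    also have "\<dots> \<le> ?I m"
      using order_less_le_trans[OF ennreal_lessI that(2)]
      by (intro nn_integral_mono mult_left_mono) (simp_all add: indicator_def)
    finally show ?thesis .
  qed
  show ?thesis
  proof (cases m)
    case (real a)
    then have "ennpowr m p = ennreal (a powr p)" by (simp add: ennpowr_ennreal)
    with lower[of a] real show ?thesis by (simp only: order_refl)
  next
    case top
    have "?I m = top"
    proof (rule ccontr)
      assume "?I m \<noteq> top"
      then obtain c where c: "?I m = ennreal c" "0 \<le> c" by (cases "?I m") auto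
      \<comment> \<open>The lower bound is tested at the level a with a^p = c + 1.\<close>
      have "ennreal (((c + 1) powr (1 / p)) powr p) \<le> ennreal c"
        using lower[of "(c + 1) powr (1 / p)"] top c(1) by simp
      then show False using c(2) assms by (simp add: powr_powr)
    qed
    then show ?thesis by simp
  qed
qed

text \<open>Cutting h off below t/2 lowers every average by at most t/2, so an average above t
  leaves one above t/2 for the truncated function, to which the weak type bound applies.\<close>

lemma hlmax_superlevel_le:
  fixes h :: "'a::euclidean_space \<Rightarrow> ennreal"
  assumes [measurable]: "h \<in> borel_measurable borel" and "0 < t"
  shows "ennreal (t / 2) * emeasure lborel {x. ennreal t < hlmax h x}
    \<le> ennreal (5 ^ DIM('a)) * (\<integral>\<^sup>+x. h x * indicator {x. ennreal (t / 2) < h x} x \<partial>lborel)"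
proof -
  let ?h = "\<lambda>x. h x * indicator {x. ennreal (t / 2) < h x} x"
  have t: "ennreal t = ennreal (t / 2) + ennreal (t / 2)"
    using \<open>0 < t\<close> by (simp flip: ennreal_plus)
  have h'[measurable]: "?h \<in> borel_measurable borel" by measurable
  have [measurable]: "hlmax ?h \<in> borel_measurable borel" by (rule measurable_hlmax) fact
  have "havg h x r \<le> havg ?h x r + ennreal (t / 2)" if "0 < r" for x r
  proof -
    have "(\<integral>\<^sup>+z\<in>ball x r. h z \<partial>lborel) \<le> (\<integral>\<^sup>+z. ?h z * indicator (ball x r) z + ennreal (t / 2) * indicator (ball x r) z \<partial>lborel)"
      by (intro nn_integral_mono) (auto simp: indicator_def not_less)
    also have "\<dots> = (\<integral>\<^sup>+z\<in>ball x r. ?h z \<partial>lborel) + ennreal (t / 2) * emeasure lborel (ball x r)"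
      by (subst nn_integral_add)
         (simp_all add: nn_integral_cmult_indicator borel_measurable_times_ennreal borel_measurable_indicator)
    finally have "havg h x r \<le> ((\<integral>\<^sup>+z\<in>ball x r. ?h z \<partial>lborel) + ennreal (t / 2) * emeasure lborel (ball x r)) / emeasure lborel (ball x r)"
      unfolding havg_def by (rule divide_right_mono_ennreal)
    also have "\<dots> = havg ?h x r + ennreal (t / 2)"
      using emeasure_ball_pos[OF that, of x]
      by (simp only: havg_def add_divide_distrib_ennreal mult_divide_eq_ennreal simp_thms)
    finally show ?thesis .
  qed
  note * = this
  have sub: "{x. ennreal t < hlmax h x} \<subseteq> {x. ennreal (t / 2) < hlmax ?h x}"
  proof (intro subsetI CollectI)
    fix x assume "x \<in> {x. ennreal t < hlmax h x}"
    then obtain k where "ennreal t < havg h x (2 powi k)"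
      by (auto simp: hlmax_def less_SUP_iff)
    then have "ennreal t < havg ?h x (2 powi k) + ennreal (t / 2)"
      by (rule order_less_le_trans) (rule *, simp)
    then have "ennreal (t / 2) < havg ?h x (2 powi k)"
      unfolding t using add_right_mono[of "havg ?h x (2 powi k)" "ennreal (t / 2)" "ennreal (t / 2)"]
      by (meson linorder_not_less)
    then show "ennreal (t / 2) < hlmax ?h x"
      unfolding hlmax_def by (auto simp: less_SUP_iff)
  qed
  have "ennreal (t / 2) * emeasure lborel {x. ennreal t < hlmax h x}
    \<le> ennreal (t / 2) * emeasure lborel {x. ennreal (t / 2) < hlmax ?h x}"
    by (rule mult_left_mono[OF emeasure_mono[OF sub]]) simp_all
  also have "\<dots> \<le> ennreal (5 ^ DIM('a)) * (\<integral>\<^sup>+x. ?h x \<partial>lborel)"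
    using \<open>0 < t\<close> by (intro hlmax_weak_type h') simp
  finally show ?thesis .
qed

text \<open>Marcinkiewicz interpolation by hand: the layer cake formula, the weak type bound for the
  truncation at each level t, and Tonelli reduce the claim to an integral in t for each fixed
  x.\<close>

theorem hlmax_strong_type:
  fixes h :: "'a::euclidean_space \<Rightarrow> ennreal"
  assumes p: "1 < p" and [measurable]: "h \<in> borel_measurable borel"
  shows "(\<integral>\<^sup>+x. ennpowr (hlmax h x) p \<partial>lborel)
    \<le> ennreal (5 ^ DIM('a) * 2 powr p * p / (p - 1)) * (\<integral>\<^sup>+x. ennpowr (h x) p \<partial>lborel)"
    (is "_ \<le> ennreal ?C * _")
proof -
  have C: "0 < ?C" using p by simp
  have [measurable]: "hlmax h \<in> borel_measurable borel" by (rule measurable_hlmax) fact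
  have m1: "(\<lambda>(x, t). ennreal (p * t powr (p - 1)) * indicator {t. 0 < t \<and> ennreal t < hlmax h x} t)
      \<in> borel_measurable (lborel \<Otimes>\<^sub>M lborel)"
    unfolding indicator_def by measurable
  have m2: "(\<lambda>(x, t). ennreal (2 * 5 ^ DIM('a) * p * t powr (p - 2)) * indicator {0<..} t * (h x * indicator {x. ennreal (t / 2) < h x} x))
      \<in> borel_measurable (lborel \<Otimes>\<^sub>M lborel)"
    unfolding indicator_def by measurable
  have "(\<integral>\<^sup>+x. ennpowr (hlmax h x) p \<partial>lborel)
    \<le> (\<integral>\<^sup>+x. \<integral>\<^sup>+t. ennreal (p * t powr (p - 1)) * indicator {t. 0 < t \<and> ennreal t < hlmax h x} t \<partial>lborel \<partial>lborel)"
    using p by (intro nn_integral_mono ennpowr_le_layer_cake) auto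
  also have "\<dots> = (\<integral>\<^sup>+t. \<integral>\<^sup>+x. ennreal (p * t powr (p - 1)) * indicator {t. 0 < t \<and> ennreal t < hlmax h x} t \<partial>lborel \<partial>lborel)"
    using lborel_pair.Fubini'[OF m1] by simp
  also have "\<dots> \<le> (\<integral>\<^sup>+t. \<integral>\<^sup>+x. ennreal (2 * 5 ^ DIM('a) * p * t powr (p - 2)) * indicator {0<..} t * (h x * indicator {x. ennreal (t / 2) < h x} x) \<partial>lborel \<partial>lborel)"
  proof (rule nn_integral_mono)
    fix t :: real
    show "(\<integral>\<^sup>+x. ennreal (p * t powr (p - 1)) * indicator {t. 0 < t \<and> ennreal t < hlmax h x} t \<partial>lborel)
      \<le> (\<integral>\<^sup>+x. ennreal (2 * 5 ^ DIM('a) * p * t powr (p - 2)) * indicator {0<..} t * (h x * indicator {x. ennreal (t / 2) < h x} x) \<partial>lborel)"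
    proof (cases "0 < t")
      case True
      let ?S = "{x. ennreal t < hlmax h x}"
      \<comment> \<open>Splits off the t/2 of \<open>hlmax_superlevel_le\<close>; the remaining
        power t^(p-2) is integrable at 0 because p > 1.\<close>
      have e: "p * t powr (p - 1) = (2 * p * t powr (p - 2)) * (t / 2)"
        using True powr_add[of t "p - 2" 1] by (simp add: algebra_simps)
      have "(\<integral>\<^sup>+x. ennreal (p * t powr (p - 1)) * indicator {t. 0 < t \<and> ennreal t < hlmax h x} t \<partial>lborel)
        = (\<integral>\<^sup>+x. ennreal (p * t powr (p - 1)) * indicator ?S x \<partial>lborel)"
        using True by (intro nn_integral_cong) (auto simp: indicator_def)
      also have "\<dots> = ennreal (2 * p * t powr (p - 2)) * (ennreal (t / 2) * emeasure lborel ?S)"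
        unfolding e using True p
        by (subst nn_integral_cmult_indicator) (simp, subst ennreal_mult, simp_all only: mult.assoc, auto)
      also have "\<dots> \<le> ennreal (2 * p * t powr (p - 2)) * (ennreal (5 ^ DIM('a)) * (\<integral>\<^sup>+x. h x * indicator {x. ennreal (t / 2) < h x} x \<partial>lborel))"
        using True by (intro mult_left_mono hlmax_superlevel_le) auto
      also have "\<dots> = ennreal (2 * 5 ^ DIM('a) * p * t powr (p - 2)) * (\<integral>\<^sup>+x. h x * indicator {x. ennreal (t / 2) < h x} x \<partial>lborel)"
        using p by (simp add: mult.assoc[symmetric] flip: ennreal_mult) (simp add: mult_ac)
      finally show ?thesis using True by (simp add: nn_integral_cmult)
    qed (simp add: indicator_def)
  qed
  also have "\<dots> = (\<integral>\<^sup>+x. \<integral>\<^sup>+t. ennreal (2 * 5 ^ DIM('a) * p * t powr (p - 2)) * indicator {0<..} t * (h x * indicator {x. ennreal (t / 2) < h x} x) \<partial>lborel \<partial>lborel)"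
    using lborel_pair.Fubini'[OF m2] by simp
  also have "\<dots> \<le> (\<integral>\<^sup>+x. ennreal ?C * ennpowr (h x) p \<partial>lborel)"
  proof (rule nn_integral_mono)
    fix x
    show "(\<integral>\<^sup>+t. ennreal (2 * 5 ^ DIM('a) * p * t powr (p - 2)) * indicator {0<..} t * (h x * indicator {x. ennreal (t / 2) < h x} x) \<partial>lborel)
      \<le> ennreal ?C * ennpowr (h x) p"
    proof (cases "h x")
      case top
      have "ennreal ?C \<noteq> 0" using C by (metis ennreal_eq_0_iff not_less)
      then show ?thesis by (simp only: top ennpowr_top ennreal_mult_top if_False top_greatest)
    next
      case (real a)
      \<comment> \<open>The truncation restricts t to (0, 2a) for a = h x, and the integral of
        t^(p-2) there is (2a)^(p-1)/(p-1).\<close>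
      have "(\<integral>\<^sup>+t. ennreal (2 * 5 ^ DIM('a) * p * t powr (p - 2)) * indicator {0<..} t * (h x * indicator {x. ennreal (t / 2) < h x} x) \<partial>lborel)
        = (\<integral>\<^sup>+t. ennreal (2 * 5 ^ DIM('a) * p * a) * (ennreal (t powr (p - 2)) * indicator {0<..<2 * a} t) \<partial>lborel)"
        using real p by (intro nn_integral_cong) (auto simp: indicator_def ennreal_less_iff ennreal_mult mult_ac)
      also have "\<dots> = ennreal (2 * 5 ^ DIM('a) * p * a) * ennreal ((2 * a) powr (p - 1) / (p - 1))"
        using nn_integral_powr_below[of "p - 2" "2 * a"] real p by (simp add: nn_integral_cmult)
      also have "\<dots> = ennreal (?C * a powr p)"
      proof -
        have "2 * a * (2 * a) powr (p - 1) = (2 * a) powr p"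
          using powr_add[of "2 * a" 1 "p - 1"] real by (cases "a = 0") auto
        then have "2 * 5 ^ DIM('a) * p * a * ((2 * a) powr (p - 1) / (p - 1)) = ?C * a powr p"
          using p real by (simp add: powr_mult field_simps)
        then show ?thesis using p real by (simp flip: ennreal_mult)
      qed
      also have "\<dots> = ennreal ?C * ennpowr (h x) p"
        using real C by (simp only: ennpowr_ennreal ennreal_mult less_imp_le powr_ge_zero)
      finally show ?thesis by simp
    qed
  qed
  also have "\<dots> = ennreal ?C * (\<integral>\<^sup>+x. ennpowr (h x) p \<partial>lborel)"
    by (simp add: nn_integral_cmult)
  finally show ?thesis .
qed

text \<open>Dyadic shells, each enlarged to a full ball, give a geometric series with ratio 2^(-b).
  Its sum decreases in b, so a lower bound \<open>b0\<close> fixes the constant; this is where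
  dependence on s disappears, as b will be \<epsilon> + s*p or n + s*p with \<open>b0\<close> equal
  to \<epsilon> or n.\<close>

lemma nn_integral_tail_powr:
  assumes "0 < b0" "b0 \<le> b" "0 < a"
  shows "(\<integral>\<^sup>+(u::'a::euclidean_space). ennreal (norm u powr (- (real DIM('a) + b))) * indicator {u. a \<le> norm u} u \<partial>lborel)
    \<le> ennreal (unit_ball_vol DIM('a) * 2 ^ DIM('a) / (1 - 2 powr - b0) * a powr - b)"
proof -
  let ?n = "DIM('a)"
  define c where "c j = 2 ^ j * a" for j
  have c0: "0 < c j" for j using assms by (simp add: c_def)
  let ?F = "\<lambda>j u. ennreal (c j powr (- (real ?n + b))) * indicator (ball 0 (2 * c j)) (u::'a)"
  have pw: "ennreal (norm u powr (- (real ?n + b))) * indicator {u. a \<le> norm u} u \<le> (\<Sum>j. ?F j u)" for u :: 'a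
  proof (cases "a \<le> norm u")
    case True
    \<comment> \<open>The shell with \<open>c j <= norm u < 2 * c j\<close>, on which the power is
      at most its value at \<open>c j\<close>.\<close>
    define j where "j = nat \<lfloor>log 2 (norm u / a)\<rfloor>"
    have "1 \<le> norm u / a" using True assms by (simp add: field_simps)
    then have l: "0 \<le> log 2 (norm u / a)" by simp
    have "real j \<le> log 2 (norm u / a)" "log 2 (norm u / a) < real j + 1"
      unfolding j_def using l by linarith+
    then have "2 powr real j \<le> 2 powr log 2 (norm u / a)" "2 powr log 2 (norm u / a) < 2 powr (real j + 1)"
      by simp_all
    moreover have "2 powr log 2 (norm u / a) = norm u / a"
      using \<open>1 \<le> norm u / a\<close> by (intro powr_log_cancel) auto
    ultimately have "2 powr real j \<le> norm u / a" "norm u / a < 2 powr (real j + 1)"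
      by simp_all
    then have j: "c j \<le> norm u" "norm u < 2 * c j"
      using assms by (simp_all add: c_def field_simps powr_realpow powr_add)
    have "norm u powr (- (real ?n + b)) \<le> c j powr (- (real ?n + b))"
      using j c0[of j] assms by (intro powr_mono2') auto
    then have "ennreal (norm u powr (- (real ?n + b))) * indicator {u. a \<le> norm u} u \<le> ?F j u"
      using j True by (auto intro: ennreal_leI)
    also have "\<dots> \<le> (\<Sum>j. ?F j u)"
      by (rule order_trans[OF _ sum_le_suminf[of "\<lambda>j. ?F j u" "{j}"]]) (simp_all only: sum.insert sum.empty finite.intros empty_iff not_False_eq_True add_0_right order_refl summableI zero_le)
    finally show ?thesis .
  qed simp
  have shell: "(\<integral>\<^sup>+u. ?F j u \<partial>lborel) = ennreal (unit_ball_vol ?n * 2 ^ ?n * a powr - b * (2 powr - b) ^ j)" for j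
  proof -
    have "c j powr (- (real ?n + b)) * (unit_ball_vol ?n * (2 * c j) ^ ?n)
        = unit_ball_vol ?n * 2 ^ ?n * (c j powr (- (real ?n + b)) * c j powr real ?n)"
      using c0[of j] by (simp add: powr_realpow power_mult_distrib)
    also have "c j powr (- (real ?n + b)) * c j powr real ?n = c j powr - b"
      using c0[of j] by (simp flip: powr_add)
    also have "c j powr - b = a powr - b * (2 powr - b) ^ j"
    proof -
      have "c j = 2 powr real j * a" by (simp add: c_def powr_realpow)
      then have "c j powr - b = 2 powr (real j * - b) * a powr - b"
        using assms by (simp add: powr_mult powr_powr)
      also have "2 powr (real j * - b) = (2 powr - b) powr real j"
        by (simp add: powr_powr mult.commute)
      finally show ?thesis by (simp add: powr_realpow mult.commute)
    qed
    finally have e: "c j powr (- (real ?n + b)) * (unit_ball_vol ?n * (2 * c j) ^ ?n)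
      = unit_ball_vol ?n * 2 ^ ?n * a powr - b * (2 powr - b) ^ j" by (simp only: mult.assoc)
    have "(\<integral>\<^sup>+u. ?F j u \<partial>lborel) = ennreal (c j powr (- (real ?n + b))) * ennreal (unit_ball_vol ?n * (2 * c j) ^ ?n)"
      using c0[of j] emeasure_ball[of "2 * c j" "0::'a"] by (subst nn_integral_cmult_indicator) auto
    also have "\<dots> = ennreal (unit_ball_vol ?n * 2 ^ ?n * a powr - b * (2 powr - b) ^ j)"
      by (subst ennreal_mult'[symmetric]) (simp_all only: e powr_ge_zero)
    finally show ?thesis .
  qed
  have b: "2 powr - b < (1::real)" "2 powr - b0 < (1::real)" "2 powr - b \<le> (2::real) powr - b0"
    using assms by (auto simp: powr_less_one)
  have "(\<integral>\<^sup>+(u::'a). ennreal (norm u powr (- (real ?n + b))) * indicator {u. a \<le> norm u} u \<partial>lborel)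
      \<le> (\<integral>\<^sup>+(u::'a). (\<Sum>j. ?F j u) \<partial>lborel)"
    by (rule nn_integral_mono, rule pw)
  also have "\<dots> = (\<Sum>j. \<integral>\<^sup>+u. ?F j u \<partial>lborel)"
    by (rule nn_integral_suminf)
       (intro borel_measurable_times_ennreal borel_measurable_indicator borel_measurable_const, simp)
  also have "\<dots> = ennreal (unit_ball_vol ?n * 2 ^ ?n * a powr - b * (1 / (1 - 2 powr - b)))"
    unfolding shell using b(1) by (intro suminf_ennreal_eq sums_mult geometric_sums) auto
  also have "\<dots> \<le> ennreal (unit_ball_vol ?n * 2 ^ ?n / (1 - 2 powr - b0) * a powr - b)"
  proof (rule ennreal_leI)
    have "1 / (1 - 2 powr - b) \<le> 1 / (1 - 2 powr - b0)"
      by (intro divide_left_mono mult_pos_pos) (use b in linarith)+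
    then have "unit_ball_vol ?n * 2 ^ ?n * a powr - b * (1 / (1 - 2 powr - b))
      \<le> unit_ball_vol ?n * 2 ^ ?n * a powr - b * (1 / (1 - 2 powr - b0))"
      by (intro mult_left_mono) auto
    then show "unit_ball_vol ?n * 2 ^ ?n * a powr - b * (1 / (1 - 2 powr - b))
      \<le> unit_ball_vol ?n * 2 ^ ?n / (1 - 2 powr - b0) * a powr - b"
      by (simp add: mult_ac)
  qed
  finally show ?thesis .
qed

subsection \<open>Averages over balls\<close>

lemma havg_eq:
  fixes h :: "'a::euclidean_space \<Rightarrow> ennreal"
  assumes "0 < r"
  shows "havg h x r = ennreal (1 / (unit_ball_vol DIM('a) * r ^ DIM('a))) * (\<integral>\<^sup>+z\<in>ball x r. h z \<partial>lborel)"
  using assms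
  by (simp add: havg_def emeasure_ball divide_ennreal_def inverse_ennreal inverse_eq_divide mult.commute)

lemma havg_mono:
  assumes "\<And>z. z \<in> ball x r \<Longrightarrow> F z \<le> F' z"
  shows "havg F x r \<le> havg F' x r"
  unfolding havg_def
  by (intro divide_right_mono_ennreal nn_integral_mono) (auto simp: assms split: split_indicator)

lemma sets_ball_borel [measurable]: "ball (x::'a::metric_space) r \<in> sets borel"
  by simp

lemma havg_add:
  fixes F F' :: "'a::euclidean_space \<Rightarrow> ennreal"
  assumes [measurable]: "F \<in> borel_measurable borel" "F' \<in> borel_measurable borel"
  shows "havg (\<lambda>z. F z + F' z) x r = havg F x r + havg F' x r"
proof -
  have "(\<integral>\<^sup>+z\<in>ball x r. (F z + F' z) \<partial>lborel)
    = (\<integral>\<^sup>+z. F z * indicator (ball x r) z + F' z * indicator (ball x r) z \<partial>lborel)"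
    by (intro nn_integral_cong) (simp add: distrib_right)
  also have "\<dots> = (\<integral>\<^sup>+z\<in>ball x r. F z \<partial>lborel) + (\<integral>\<^sup>+z\<in>ball x r. F' z \<partial>lborel)"
    by (rule nn_integral_add) simp_all
  finally show ?thesis
    by (simp add: havg_def add_divide_distrib_ennreal)
qed

lemma havg_cmult:
  fixes F :: "'a::euclidean_space \<Rightarrow> ennreal"
  assumes [measurable]: "F \<in> borel_measurable borel"
  shows "havg (\<lambda>z. c * F z) x r = c * havg F x r"
  unfolding havg_def mult.assoc
  by (subst nn_integral_cmult) (simp_all add: ennreal_times_divide)

lemma havg_const:
  assumes "0 < r" shows "havg (\<lambda>_. c) (x::'a::euclidean_space) r = c"
proof -
  have "havg (\<lambda>_. c) x r = c * emeasure lborel (ball x r) / emeasure lborel (ball x r)"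
    unfolding havg_def by (subst nn_integral_cmult_indicator) simp_all
  also have "\<dots> = c"
    using emeasure_ball_pos[OF assms, of x] by (rule mult_divide_eq_ennreal)
  finally show ?thesis .
qed

lemma nn_integral_lborel_translate:
  fixes F :: "'a::euclidean_space \<Rightarrow> ennreal"
  assumes [measurable]: "F \<in> borel_measurable borel"
  shows "(\<integral>\<^sup>+z. F (w + z) \<partial>lborel) = (\<integral>\<^sup>+z. F z \<partial>lborel)"
proof -
  have "(\<integral>\<^sup>+z. F z \<partial>lborel) = (\<integral>\<^sup>+z. F z \<partial>distr lborel borel ((+) w))"
    by (simp add: lborel_distr_plus)
  also have "\<dots> = (\<integral>\<^sup>+z. F (w + z) \<partial>lborel)"
    by (subst nn_integral_distr) simp_all
  finally show ?thesis by simp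
qed

lemma havg_translate:
  fixes F :: "'a::euclidean_space \<Rightarrow> ennreal"
  assumes [measurable]: "F \<in> borel_measurable borel"
  shows "havg (\<lambda>z. F (w + z)) x r = havg F (w + x) r"
proof -
  have "(\<integral>\<^sup>+z\<in>ball x r. F (w + z) \<partial>lborel) = (\<integral>\<^sup>+z. F (w + z) * indicator (ball (w + x) r) (w + z) \<partial>lborel)"
    by (intro nn_integral_cong) (auto simp: indicator_def dist_norm)
  also have "\<dots> = (\<integral>\<^sup>+z\<in>ball (w + x) r. F z \<partial>lborel)"
    by (rule nn_integral_lborel_translate) simp
  finally show ?thesis
    unfolding havg_def by (cases "0 \<le> r") (auto simp: emeasure_ball ball_empty)
qed

lemma havg_scale:
  fixes F :: "'a::euclidean_space \<Rightarrow> ennreal"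
  assumes [measurable]: "F \<in> borel_measurable borel" and "0 < c" "0 < r"
  shows "havg (\<lambda>z. F (x + c *\<^sub>R (z - x))) x r = havg F x (c * r)"
proof -
  let ?n = "DIM('a)"
  have "(\<integral>\<^sup>+z\<in>ball x (c * r). F z \<partial>lborel)
      = (\<integral>\<^sup>+z\<in>ball x (c * r). F z \<partial>density (distr lborel borel (\<lambda>z. (x - c *\<^sub>R x) + c *\<^sub>R z)) (\<lambda>_. ennreal (\<bar>c\<bar> ^ ?n)))"
    using assms by (subst lborel_affine[of c "x - c *\<^sub>R x"]) simp_all
  also have "\<dots> = ennreal (c ^ ?n) * (\<integral>\<^sup>+z. F ((x - c *\<^sub>R x) + c *\<^sub>R z) * indicator (ball x (c * r)) ((x - c *\<^sub>R x) + c *\<^sub>R z) \<partial>lborel)"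
    using assms by (simp add: nn_integral_density nn_integral_distr nn_integral_cmult flip: ennreal_power)
  also have "(\<integral>\<^sup>+z. F ((x - c *\<^sub>R x) + c *\<^sub>R z) * indicator (ball x (c * r)) ((x - c *\<^sub>R x) + c *\<^sub>R z) \<partial>lborel)
     = (\<integral>\<^sup>+z\<in>ball x r. F (x + c *\<^sub>R (z - x)) \<partial>lborel)"
  proof (rule nn_integral_cong)
    fix z
    have e: "(x - c *\<^sub>R x) + c *\<^sub>R z = x + c *\<^sub>R (z - x)" by (simp add: algebra_simps)
    have "dist x (x + c *\<^sub>R (z - x)) = c * dist x z"
      using assms by (simp add: dist_norm norm_minus_commute)
    then have "x + c *\<^sub>R (z - x) \<in> ball x (c * r) \<longleftrightarrow> z \<in> ball x r"
      using assms by simp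
    then show "F ((x - c *\<^sub>R x) + c *\<^sub>R z) * indicator (ball x (c * r)) ((x - c *\<^sub>R x) + c *\<^sub>R z)
      = F (x + c *\<^sub>R (z - x)) * indicator (ball x r) z"
      unfolding e indicator_def by simp
  qed
  finally have I: "(\<integral>\<^sup>+z\<in>ball x (c * r). F z \<partial>lborel) = ennreal (c ^ ?n) * (\<integral>\<^sup>+z\<in>ball x r. F (x + c *\<^sub>R (z - x)) \<partial>lborel)" .
  have "havg F x (c * r) = (ennreal (1 / (unit_ball_vol ?n * (c * r) ^ ?n)) * ennreal (c ^ ?n)) * (\<integral>\<^sup>+z\<in>ball x r. F (x + c *\<^sub>R (z - x)) \<partial>lborel)"
    using assms by (subst havg_eq) (simp_all add: I mult.assoc)
  also have "ennreal (1 / (unit_ball_vol ?n * (c * r) ^ ?n)) * ennreal (c ^ ?n) = ennreal (1 / (unit_ball_vol ?n * r ^ ?n))"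
    using assms by (subst ennreal_mult[symmetric]) (simp_all add: power_mult_distrib)
  finally show ?thesis using assms by (simp add: havg_eq)
qed

lemma havg_swap:
  fixes k :: "'a::euclidean_space \<Rightarrow> 'a \<Rightarrow> ennreal"
  assumes k[measurable]: "(\<lambda>(w, z). k w z) \<in> borel_measurable (borel \<Otimes>\<^sub>M borel)" and "0 < r" "0 < r'"
  shows "havg (\<lambda>z. havg (\<lambda>w. k w z) a r') x r = havg (\<lambda>w. havg (\<lambda>z. k w z) x r) a r'"
proof -
  define c where "c r = ennreal (1 / (unit_ball_vol DIM('a) * r ^ DIM('a)))" for r
  have [measurable]: "(\<lambda>z. k w z) \<in> borel_measurable borel" "(\<lambda>w. k w z) \<in> borel_measurable borel" for w z
    by measurable
  have m: "(\<lambda>(w, z). k w z * indicator (ball a r') w * indicator (ball x r) z) \<in> borel_measurable (lborel \<Otimes>\<^sub>M lborel)"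
    by measurable
  have "havg (\<lambda>z. havg (\<lambda>w. k w z) a r') x r
      = c r * (\<integral>\<^sup>+z. c r' * (\<integral>\<^sup>+w. k w z * indicator (ball a r') w * indicator (ball x r) z \<partial>lborel) \<partial>lborel)"
    unfolding havg_eq[OF assms(2)] havg_eq[OF assms(3)] c_def
    by (rule arg_cong2[where f = "(*)", OF refl nn_integral_cong]) (auto simp: indicator_def)
  also have "\<dots> = c r * c r' * (\<integral>\<^sup>+z. \<integral>\<^sup>+w. k w z * indicator (ball a r') w * indicator (ball x r) z \<partial>lborel \<partial>lborel)"
    by (subst nn_integral_cmult) (simp_all add: mult.assoc)
  also have "(\<integral>\<^sup>+z. \<integral>\<^sup>+w. k w z * indicator (ball a r') w * indicator (ball x r) z \<partial>lborel \<partial>lborel)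
     = (\<integral>\<^sup>+w. \<integral>\<^sup>+z. k w z * indicator (ball a r') w * indicator (ball x r) z \<partial>lborel \<partial>lborel)"
    by (rule lborel_pair.Fubini'[OF m])
  also have "c r * c r' * \<dots> = c r' * (\<integral>\<^sup>+w. c r * (\<integral>\<^sup>+z. k w z * indicator (ball a r') w * indicator (ball x r) z \<partial>lborel) \<partial>lborel)"
    by (subst nn_integral_cmult) (simp_all add: mult_ac)
  also have "\<dots> = c r' * (\<integral>\<^sup>+w. (c r * (\<integral>\<^sup>+z. k w z * indicator (ball x r) z \<partial>lborel)) * indicator (ball a r') w \<partial>lborel)"
    by (rule arg_cong2[where f = "(*)", OF refl nn_integral_cong]) (auto simp: indicator_def)
  also have "\<dots> = havg (\<lambda>w. havg (\<lambda>z. k w z) x r) a r'"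
    using assms(2,3) by (simp add: havg_eq c_def)
  finally show ?thesis .
qed

lemma ennpowr_havg_le:
  fixes h :: "'a::euclidean_space \<Rightarrow> ennreal"
  assumes "1 < p" "h \<in> borel_measurable borel" "0 < r"
  shows "ennpowr (havg h x r) p \<le> ennreal (2 powr p) * havg (\<lambda>z. ennpowr (h z) p) x r"
  unfolding havg_def using assms emeasure_ball_pos[OF assms(3), of x]
  by (intro ennpowr_average_le) simp_all

subsection \<open>Pointwise comparison of averages\<close>

text \<open>Both indicators are built in so that integrating over all shifts w and all z yields only
  pairs in G x G; for balls inside G they are invisible.\<close>

definition tdiff :: "('a::euclidean_space \<Rightarrow> real) \<Rightarrow> 'a set \<Rightarrow> 'a \<Rightarrow> 'a \<Rightarrow> ennreal" where
  "tdiff g G w z = ennreal (\<bar>g z - g (z + w)\<bar> * indicator G z * indicator G (z + w))"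

definition hquot :: "('a::euclidean_space \<Rightarrow> real) \<Rightarrow> 'a set \<Rightarrow> real \<Rightarrow> 'a \<Rightarrow> 'a \<Rightarrow> ennreal" where
  "hquot g G q y w = ennreal (\<bar>g w - g y\<bar> * norm (w - y) powr - q * indicator G w)"

lemma measurable_tdiff [measurable]:
  fixes g :: "'a::euclidean_space \<Rightarrow> real"
  assumes [measurable]: "g \<in> borel_measurable borel" "G \<in> sets borel"
    and [measurable]: "X \<in> borel_measurable M" "Y \<in> borel_measurable M"
  shows "(\<lambda>v. tdiff g G (X v) (Y v)) \<in> borel_measurable M"
  unfolding tdiff_def by measurable

lemma measurable_hquot [measurable]:
  fixes g :: "'a::euclidean_space \<Rightarrow> real"
  assumes [measurable]: "g \<in> borel_measurable borel" "G \<in> sets borel"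
    and [measurable]: "X \<in> borel_measurable M" "Y \<in> borel_measurable M"
  shows "(\<lambda>v. hquot g G q (X v) (Y v)) \<in> borel_measurable M"
  unfolding hquot_def by measurable

lemma measurable_hlmax_tdiff:
  fixes g :: "'a::euclidean_space \<Rightarrow> real"
  assumes [measurable]: "g \<in> borel_measurable borel" "G \<in> sets borel"
    and [measurable]: "X \<in> borel_measurable M" "Y \<in> borel_measurable M"
  shows "(\<lambda>v. hlmax (tdiff g G (X v)) (Y v)) \<in> borel_measurable M"
  by (rule measurable_hlmax_pair) measurable

lemma measurable_hlmax_hquot:
  fixes g :: "'a::euclidean_space \<Rightarrow> real"
  assumes [measurable]: "g \<in> borel_measurable borel" "G \<in> sets borel"
    and [measurable]: "X \<in> borel_measurable M" "Y \<in> borel_measurable M"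
  shows "(\<lambda>v. hlmax (hquot g G q (X v)) (Y v)) \<in> borel_measurable M"
  by (rule measurable_hlmax_pair) measurable

context
  fixes g :: "'a::euclidean_space \<Rightarrow> real" and G :: "'a set"
  assumes g[measurable]: "g \<in> borel_measurable borel" and g0: "\<And>z. 0 \<le> g z"
    and G[measurable]: "G \<in> sets borel"
begin

lemma ennreal_le_add_diff: "ennreal (g z) \<le> ennreal (g v) + ennreal \<bar>g z - g v\<bar>"
  by (simp add: g0 ennreal_leI flip: ennreal_plus)

text \<open>Translation by y - x carries one ball onto the other. The error is a maximal function of
  a difference with fixed shift, so it can later be integrated in x for each shift
  separately.\<close>

lemma havg_le_shifted:
  assumes "0 < r" "ball x r \<subseteq> G" "ball y r \<subseteq> G"
  shows "havg g x r \<le> havg g y r + ennreal (2 ^ DIM('a)) * hlmax (tdiff g G (y - x)) x"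
proof -
  let ?w = "y - x"
  have "havg g x r \<le> havg (\<lambda>z. ennreal (g (?w + z)) + tdiff g G ?w z) x r"
  proof (rule havg_mono)
    fix z assume z: "z \<in> ball x r"
    then have "z + ?w \<in> ball y r" by (simp add: dist_norm algebra_simps)
    with z assms have "z \<in> G" "z + ?w \<in> G" by blast+
    then show "ennreal (g z) \<le> ennreal (g (?w + z)) + tdiff g G ?w z"
      using ennreal_le_add_diff[of z "z + ?w"] by (simp add: tdiff_def add.commute)
  qed
  also have "\<dots> = havg (\<lambda>z. ennreal (g (?w + z))) x r + havg (tdiff g G ?w) x r"
    by (rule havg_add) measurable
  also have "havg (\<lambda>z. ennreal (g (?w + z))) x r = havg g y r"
    using havg_translate[of "\<lambda>z. ennreal (g z)" ?w x r] by simp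
  also have "havg (tdiff g G ?w) x r \<le> ennreal (2 ^ DIM('a)) * hlmax (tdiff g G ?w) x"
    by (rule havg_le_hlmax) fact
  finally show ?thesis by (simp add: add_left_mono)
qed

lemma havg_le_point:
  assumes "0 < r"
  shows "havg g x r \<le> ennreal (g y) + havg (\<lambda>w. ennreal \<bar>g w - g y\<bar>) x r"
proof -
  have "havg g x r \<le> havg (\<lambda>w. ennreal (g y) + ennreal \<bar>g w - g y\<bar>) x r"
    by (intro havg_mono ennreal_le_add_diff)
  also have "\<dots> = ennreal (g y) + havg (\<lambda>w. ennreal \<bar>g w - g y\<bar>) x r"
    using assms by (subst havg_add) (simp_all add: havg_const)
  finally show ?thesis .
qed

text \<open>Points w of the ball satisfy \<open>norm (w - y) <= 2 * dist x y\<close>, so the factor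
  \<open>((2 * dist x y) / norm (w - y)) ^ q\<close> may be inserted at will. The result is free of
  r.\<close>

lemma havg_diff_le_hquot:
  assumes "0 < r" "r \<le> dist x y" "ball x r \<subseteq> G" "0 < q"
  shows "havg (\<lambda>w. ennreal \<bar>g w - g y\<bar>) x r
    \<le> ennreal ((2 * dist x y) powr q) * (ennreal (2 ^ DIM('a)) * hlmax (hquot g G q y) x)"
proof -
  have "havg (\<lambda>w. ennreal \<bar>g w - g y\<bar>) x r
    \<le> havg (\<lambda>w. ennreal ((2 * dist x y) powr q) * hquot g G q y w) x r"
  proof (rule havg_mono)
    fix w assume w: "w \<in> ball x r"
    show "ennreal \<bar>g w - g y\<bar> \<le> ennreal ((2 * dist x y) powr q) * hquot g G q y w"
    proof (cases "w = y")
      case False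
      have "norm (w - y) \<le> 2 * dist x y"
        using w assms dist_triangle[of w y x] by (simp add: dist_norm norm_minus_commute)
      then have "norm (w - y) powr q \<le> (2 * dist x y) powr q"
        using assms by (intro powr_mono2) auto
      then have "\<bar>g w - g y\<bar> * (norm (w - y) powr - q * norm (w - y) powr q)
        \<le> \<bar>g w - g y\<bar> * (norm (w - y) powr - q * (2 * dist x y) powr q)"
        by (intro mult_left_mono) auto
      moreover have "norm (w - y) powr - q * norm (w - y) powr q = 1"
        using False by (simp flip: powr_add)
      ultimately have "\<bar>g w - g y\<bar> \<le> (2 * dist x y) powr q * (\<bar>g w - g y\<bar> * norm (w - y) powr - q * indicator G w)"
        using w assms by (auto simp: mult_ac)
      then show ?thesis
        unfolding hquot_def by (subst ennreal_mult'[symmetric]) (auto intro: ennreal_leI)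
    qed simp
  qed
  also have "\<dots> = ennreal ((2 * dist x y) powr q) * havg (hquot g G q y) x r"
    by (rule havg_cmult) measurable
  also have "\<dots> \<le> ennreal ((2 * dist x y) powr q) * (ennreal (2 ^ DIM('a)) * hlmax (hquot g G q y) x)"
    using assms by (intro mult_left_mono havg_le_hlmax) auto
  finally show ?thesis .
qed

text \<open>In r^(-n) = r^(\<epsilon>-n) * r^(-\<epsilon>) both exponents are nonpositive, while r
  is at least \<open>norm (w - y) / 2\<close> and at least \<open>dist x y\<close>. What results is
  an integral operator with an explicit kernel, to be handled by Tonelli alone; r survives only
  through its upper bound \<open>D\<close> in the cutoff.\<close>

lemma havg_powr_le_weighted:
  fixes \<epsilon> :: real
  assumes "0 < dist x y" "dist x y \<le> r" "r \<le> D" "ball x r \<subseteq> G" "0 < \<epsilon>" "\<epsilon> < 1"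
  shows "havg (\<lambda>w. ennpowr (ennreal \<bar>g w - g y\<bar>) p) x r
    \<le> ennreal (2 ^ DIM('a) / unit_ball_vol DIM('a)) *
      (\<integral>\<^sup>+w\<in>G. ennpowr (ennreal \<bar>g w - g y\<bar>) p *
        ennreal (norm (w - y) powr (\<epsilon> - DIM('a)) * dist x y powr - \<epsilon> * indicator {w. norm (w - y) \<le> 2 * D} w) \<partial>lborel)"
proof -
  let ?n = "DIM('a)" and ?F = "\<lambda>w. ennpowr (ennreal \<bar>g w - g y\<bar>) p"
  let ?c = "unit_ball_vol (real ?n)"
  let ?W = "\<lambda>w. norm (w - y) powr (\<epsilon> - ?n) * dist x y powr - \<epsilon> * indicator {w. norm (w - y) \<le> 2 * D} w"
  have r: "0 < r" using assms by linarith
  have en: "\<epsilon> \<le> real ?n" using DIM_positive[where 'a='a] assms by linarith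
  have "havg ?F x r = (\<integral>\<^sup>+w. ennreal (1 / (?c * r ^ ?n)) * (?F w * indicator (ball x r) w) \<partial>lborel)"
    using r by (simp add: havg_eq nn_integral_cmult)
  also have "\<dots> \<le> (\<integral>\<^sup>+w. ennreal (2 ^ ?n / ?c) * (?F w * ennreal (?W w) * indicator G w) \<partial>lborel)"
  proof (rule nn_integral_mono)
    fix w
    show "ennreal (1 / (?c * r ^ ?n)) * (?F w * indicator (ball x r) w)
      \<le> ennreal (2 ^ ?n / ?c) * (?F w * ennreal (?W w) * indicator G w)"
    proof (cases "w \<in> ball x r \<and> w \<noteq> y")
      case True
      then have w: "w \<in> ball x r" "w \<noteq> y" by auto
      let ?a = "norm (w - y)"
      have a: "0 < ?a" "?a \<le> 2 * r"
        using w assms dist_triangle[of w y x] by (simp_all add: dist_norm norm_minus_commute)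
      have "1 / r ^ ?n = r powr (\<epsilon> - ?n) * r powr - \<epsilon>"
        using r by (simp add: powr_diff powr_minus_divide powr_realpow)
      also have "\<dots> \<le> (?a / 2) powr (\<epsilon> - ?n) * dist x y powr - \<epsilon>"
        using a en assms by (intro mult_mono powr_mono2') auto
      also have "(?a / 2) powr (\<epsilon> - ?n) = ?a powr (\<epsilon> - ?n) * 2 powr (?n - \<epsilon>)"
        using a by (simp add: powr_divide powr_diff)
      also have "\<dots> * dist x y powr - \<epsilon> \<le> ?a powr (\<epsilon> - ?n) * 2 powr ?n * dist x y powr - \<epsilon>"
        using assms by (intro mult_right_mono mult_left_mono powr_mono) auto
      finally have "1 / r ^ ?n \<le> 2 ^ ?n * ?W w"
        using a assms by (simp add: powr_realpow mult_ac)
      then have "(1 / ?c) * (1 / r ^ ?n) \<le> (1 / ?c) * (2 ^ ?n * ?W w)"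
        by (intro mult_left_mono) auto
      then have "ennreal (1 / (?c * r ^ ?n)) \<le> ennreal ((2 ^ ?n / ?c) * ?W w)"
        by (intro ennreal_leI) simp
      also have "\<dots> = ennreal (2 ^ ?n / ?c) * ennreal (?W w)"
        by (rule ennreal_mult') simp
      finally have "ennreal (1 / (?c * r ^ ?n)) * ?F w \<le> ennreal (2 ^ ?n / ?c) * ennreal (?W w) * ?F w"
        by (rule mult_right_mono) simp
      then show ?thesis
        using w assms by (auto simp: mult_ac)
    next
      case False
      then show ?thesis by (cases "w = y") (auto simp: ennpowr_0)
    qed
  qed
  also have "\<dots> = ennreal (2 ^ ?n / ?c) * (\<integral>\<^sup>+w\<in>G. ?F w * ennreal (?W w) \<partial>lborel)"
    by (rule nn_integral_cmult) measurable
  finally show ?thesis .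
qed

text \<open>Once the averages are exchanged, the inner one runs over z for a fixed shift, so the
  maximal operator absorbs it together with its radius.\<close>

lemma havg_tdiff_le_hlmax:
  assumes "0 < r" "0 < h"
  shows "havg (\<lambda>z. havg (\<lambda>w. tdiff g G w z) 0 h) x r
    \<le> ennreal (2 ^ DIM('a)) * havg (\<lambda>w. hlmax (tdiff g G w) x) 0 h"
proof -
  have "havg (\<lambda>z. havg (\<lambda>w. tdiff g G w z) 0 h) x r = havg (\<lambda>w. havg (tdiff g G w) x r) 0 h"
    using assms by (intro havg_swap) simp_all
  also have "\<dots> \<le> havg (\<lambda>w. ennreal (2 ^ DIM('a)) * hlmax (tdiff g G w) x) 0 h"
    using assms by (intro havg_mono havg_le_hlmax)
  also have "\<dots> = ennreal (2 ^ DIM('a)) * havg (\<lambda>w. hlmax (tdiff g G w) x) 0 h"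
    by (intro havg_cmult measurable_hlmax_tdiff) simp_all
  finally show ?thesis .
qed

text \<open>The balls are compared through averages over \<open>ball (x + (\<rho> / r) *\<^sub>R (z - x)) h\<close>, which is contained
  in \<open>ball x r\<close> for every \<open>z \<in> ball x r\<close> as \<open>\<rho> + h = r\<close>.\<close>

lemma havg_le_concentric:
  assumes "0 < h" "h < r" "ball x r \<subseteq> G"
  shows "havg g x r \<le> havg g x (r - h)
    + ennreal (2 * 4 ^ DIM('a)) * havg (\<lambda>w. hlmax (tdiff g G w) x) 0 (2 * h)"
proof -
  let ?n = "DIM('a)"
  \<comment> \<open>The ratio that makes \<open>Z\<close> below map \<open>ball x r\<close> onto
    \<open>ball x (r - h)\<close> while moving each point by at most h.\<close>
  define k where "k = (r - h) / r"
  have r: "0 < r" and k: "0 < k" "k * r = r - h" "1 - k = h / r"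
    using assms by (auto simp: k_def field_simps)
  define Z where "Z z = x + k *\<^sub>R (z - x)" for z
  have [measurable]: "Z \<in> borel_measurable borel" unfolding Z_def by measurable
  \<comment> \<open>The factor 2^n pays for replacing a ball of radius h near z by the ball of
    radius 2h of shifts from z, as done in \<open>avg_le\<close>.\<close>
  define D where "D z = ennreal (2 ^ ?n) * havg (\<lambda>w. tdiff g G w z) 0 (2 * h)" for z
  have mD: "(\<lambda>v. D (X v)) \<in> borel_measurable borel" if [measurable]: "X \<in> borel_measurable borel" for X :: "'a \<Rightarrow> 'a"
    unfolding D_def by (intro borel_measurable_times_ennreal measurable_havg_pair) simp_all
  have inG: "v \<in> G" if "z \<in> ball x r" "v \<in> ball (Z z) h" for z v
  proof -
    have "dist x (Z z) = k * dist x z"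
      using k by (simp add: Z_def dist_norm norm_minus_commute)
    also have "\<dots> < k * r" using k(1) that(1) by (intro mult_strict_left_mono) auto
    finally have "dist x v < r" using that k dist_triangle[of x v "Z z"] by simp
    then show ?thesis using assms by auto
  qed
  \<comment> \<open>Applied twice with a = \<open>Z z\<close>: once to compare z with the average,
    once to compare \<open>Z z\<close> itself with it.\<close>
  have avg_le: "havg (\<lambda>v. ennreal \<bar>g z - g v\<bar>) a h \<le> D z"
    if sub: "ball a h \<subseteq> G" and z: "z \<in> G" "dist a z \<le> h" for a z
  proof -
    let ?F = "\<lambda>v. ennreal \<bar>g z - g v\<bar>"
    have "(\<integral>\<^sup>+v\<in>ball a h. ?F v \<partial>lborel) = (\<integral>\<^sup>+w. ?F (z + w) * indicator (ball a h) (z + w) \<partial>lborel)"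
      by (rule nn_integral_lborel_translate[symmetric]) simp
    also have "\<dots> \<le> (\<integral>\<^sup>+w\<in>ball 0 (2 * h). tdiff g G w z \<partial>lborel)"
    proof (rule nn_integral_mono)
      fix w
      show "?F (z + w) * indicator (ball a h) (z + w) \<le> tdiff g G w z * indicator (ball 0 (2 * h)) w"
      proof (cases "z + w \<in> ball a h")
        case True
        then have "dist z (z + w) < 2 * h"
          using z dist_triangle[of z "z + w" a] by (simp add: dist_commute)
        then have "norm w < 2 * h" by (simp add: dist_norm)
        with True sub z show ?thesis by (auto simp: tdiff_def)
      qed simp
    qed
    finally have I: "(\<integral>\<^sup>+v\<in>ball a h. ?F v \<partial>lborel) \<le> (\<integral>\<^sup>+w\<in>ball 0 (2 * h). tdiff g G w z \<partial>lborel)" .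
    have "havg ?F a h \<le> ennreal (1 / (unit_ball_vol ?n * h ^ ?n)) * (\<integral>\<^sup>+w\<in>ball 0 (2 * h). tdiff g G w z \<partial>lborel)"
      using assms I by (simp add: havg_eq mult_left_mono)
    also have "ennreal (1 / (unit_ball_vol ?n * h ^ ?n)) = ennreal (2 ^ ?n) * ennreal (1 / (unit_ball_vol ?n * (2 * h) ^ ?n))"
      using assms by (subst ennreal_mult[symmetric]) (simp_all add: power_mult_distrib)
    finally show ?thesis
      using assms by (simp add: D_def havg_eq mult.assoc)
  qed
  let ?E = "ennreal (4 ^ ?n) * havg (\<lambda>w. hlmax (tdiff g G w) x) 0 (2 * h)"
  have D_le: "havg D x s \<le> ?E" if "0 < s" for s
  proof -
    have "havg D x s = ennreal (2 ^ ?n) * havg (\<lambda>z. havg (\<lambda>w. tdiff g G w z) 0 (2 * h)) x s"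
      unfolding D_def by (intro havg_cmult measurable_havg_pair) simp_all
    also have "\<dots> \<le> ennreal (2 ^ ?n) * (ennreal (2 ^ ?n) * havg (\<lambda>w. hlmax (tdiff g G w) x) 0 (2 * h))"
      using that assms by (intro mult_left_mono havg_tdiff_le_hlmax) auto
    also have "\<dots> = ?E"
      by (simp add: mult.assoc[symmetric] flip: ennreal_mult power_mult_distrib)
    finally show ?thesis .
  qed
  have "havg g x r \<le> havg (\<lambda>z. ennreal (g (Z z)) + D (Z z) + D z) x r"
  proof (rule havg_mono)
    fix z assume z: "z \<in> ball x r"
    have dz: "dist (Z z) z \<le> h"
    proof -
      have "z - Z z = (1 - k) *\<^sub>R (z - x)" by (simp add: Z_def algebra_simps)
      then have "dist (Z z) z = (h / r) * dist x z"
        using k assms r by (simp add: dist_norm norm_minus_commute)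
      also have "\<dots> \<le> (h / r) * r" using z assms r by (intro mult_left_mono) auto
      finally show ?thesis using r by simp
    qed
    have sub: "ball (Z z) h \<subseteq> G" using inG[OF z] by blast
    have "ennreal (g z) = havg (\<lambda>_. ennreal (g z)) (Z z) h"
      using assms by (simp add: havg_const)
    also have "\<dots> \<le> havg (\<lambda>v. ennreal (g v) + ennreal \<bar>g z - g v\<bar>) (Z z) h"
      by (intro havg_mono ennreal_le_add_diff)
    also have "\<dots> = havg g (Z z) h + havg (\<lambda>v. ennreal \<bar>g z - g v\<bar>) (Z z) h"
      by (intro havg_add) measurable
    also have "havg (\<lambda>v. ennreal \<bar>g z - g v\<bar>) (Z z) h \<le> D z"
      using z assms dz by (intro avg_le sub) auto
    also have "havg g (Z z) h \<le> ennreal (g (Z z)) + havg (\<lambda>v. ennreal \<bar>g v - g (Z z)\<bar>) (Z z) h"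
      using assms by (intro havg_le_point)
    also have "havg (\<lambda>v. ennreal \<bar>g v - g (Z z)\<bar>) (Z z) h \<le> D (Z z)"
    proof -
      have "Z z \<in> G" using sub assms(1) by auto
      then show ?thesis
        using sub assms(1) avg_le[of "Z z" "Z z"] by (simp add: abs_minus_commute)
    qed
    finally show "ennreal (g z) \<le> ennreal (g (Z z)) + D (Z z) + D z"
      by (simp add: add_mono)
  qed
  also have "\<dots> = havg (\<lambda>z. ennreal (g (Z z))) x r + havg (\<lambda>z. D (Z z)) x r + havg D x r"
  proof -
    have [measurable]: "D \<in> borel_measurable borel" "(\<lambda>z. D (Z z)) \<in> borel_measurable borel"
      using mD[of "\<lambda>x. x"] mD[of Z] by simp_all
    have "havg (\<lambda>z. ennreal (g (Z z)) + D (Z z) + D z) x r = havg (\<lambda>z. ennreal (g (Z z)) + D (Z z)) x r + havg D x r"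
      by (rule havg_add) measurable
    also have "havg (\<lambda>z. ennreal (g (Z z)) + D (Z z)) x r = havg (\<lambda>z. ennreal (g (Z z))) x r + havg (\<lambda>z. D (Z z)) x r"
      by (rule havg_add) measurable
    finally show ?thesis .
  qed
  also have "havg (\<lambda>z. ennreal (g (Z z))) x r = havg g x (r - h)"
    unfolding Z_def k(2)[symmetric] by (rule havg_scale) (use r k in auto)
  \<comment> \<open>Dilation turns this into an average of \<open>D\<close> itself over a concentric
    ball, so \<open>D_le\<close> covers both error terms.\<close>
  also have "havg (\<lambda>z. D (Z z)) x r = havg D x (r - h)"
    unfolding Z_def k(2)[symmetric] by (rule havg_scale) (use r k mD[of "\<lambda>x. x"] in auto)
  also have "havg g x (r - h) + havg D x (r - h) + havg D x r \<le> havg g x (r - h) + ?E + ?E"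
    using D_le[of r] D_le[of "r - h"] r assms by (intro add_mono) auto
  also have "\<dots> = havg g x (r - h)
    + ennreal (2 * 4 ^ ?n) * havg (\<lambda>w. hlmax (tdiff g G w) x) 0 (2 * h)"
    by (simp add: ennreal_mult add.assoc mult.assoc mult_2[symmetric] flip: numeral_mult_ennreal)
  finally show ?thesis .
qed

end

section \<open>Error terms and the comparison for a single radius\<close>

definition skernel :: "real \<Rightarrow> 'a::euclidean_space \<Rightarrow> ennreal" where
  "skernel b v = ennreal (norm v powr - (real DIM('a) + b))"

definition pdiff :: "('a::euclidean_space \<Rightarrow> real) \<Rightarrow> real \<Rightarrow> 'a \<Rightarrow> 'a \<Rightarrow> ennreal" where
  "pdiff g p x y = ennpowr (ennreal \<bar>g x - g y\<bar>) p"

definition shift_term :: "('a::euclidean_space \<Rightarrow> real) \<Rightarrow> 'a set \<Rightarrow> real \<Rightarrow> 'a \<Rightarrow> 'a \<Rightarrow> ennreal" where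
  "shift_term g G p x y = ennpowr (hlmax (tdiff g G (y - x)) x) p"

text \<open>The order n/p + s of the quotient is the one whose p-th power is the kernel exponent n +
  s*p, so the prefactor cancels the singular kernel exactly.\<close>

definition near_term :: "('a::euclidean_space \<Rightarrow> real) \<Rightarrow> 'a set \<Rightarrow> real \<Rightarrow> real \<Rightarrow> 'a \<Rightarrow> 'a \<Rightarrow> ennreal" where
  "near_term g G p s x y =
     ennreal (dist x y powr (real DIM('a) + s * p)) * ennpowr (hlmax (hquot g G (real DIM('a) / p + s) y) x) p"

definition middle_term :: "('a::euclidean_space \<Rightarrow> real) \<Rightarrow> 'a set \<Rightarrow> real \<Rightarrow> real \<Rightarrow> real \<Rightarrow> 'a \<Rightarrow> 'a \<Rightarrow> ennreal" where
  "middle_term g G p \<epsilon> l x y =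
     (\<integral>\<^sup>+w\<in>G. pdiff g p w y * ennreal (norm (w - y) powr (\<epsilon> - real DIM('a)) * dist x y powr - \<epsilon> *
        indicator {w. norm (w - y) \<le> 2 * (2 * l * dist x y)} w) \<partial>lborel)"

text \<open>The p-th power stands inside the average over shifts, by Jensen, which makes the term
  linear in its values at the individual w; the integral over y can then be computed for each
  w.\<close>

definition far_term :: "('a::euclidean_space \<Rightarrow> real) \<Rightarrow> 'a set \<Rightarrow> real \<Rightarrow> real \<Rightarrow> 'a \<Rightarrow> 'a \<Rightarrow> ennreal" where
  "far_term g G p l x y = havg (\<lambda>w. ennpowr (hlmax (tdiff g G w) x) p) 0 (2 * (l * dist x y))"

text \<open>One summand for each of the near, middle, shift and far terms, with s already replaced
  by its bound 1. The final 1 serves radius 0, where the bare difference must be dominated.\<close>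

definition pointwise_const :: "real \<Rightarrow> nat \<Rightarrow> real" where
  "pointwise_const p n = 2 powr (real n + p) * (2 ^ n) powr p + 2 powr p * (2 ^ n / unit_ball_vol n)
     + 2 powr p * (2 ^ n) powr p + 2 powr p * ((2 * 4 ^ n) powr p * 2 powr p) + 1"

lemma pointwise_const_bounds:
  shows "2 powr (real n + p) * (2 ^ n) powr p \<le> pointwise_const p n"
    and "2 powr p * (2 ^ n / unit_ball_vol n) \<le> pointwise_const p n"
    and "2 powr p * (2 ^ n) powr p \<le> pointwise_const p n"
    and "2 powr p * ((2 * 4 ^ n) powr p * 2 powr p) \<le> pointwise_const p n"
    and "1 \<le> pointwise_const p n"
  by (simp_all add: pointwise_const_def add_increasing add_increasing2)

context
  fixes g :: "'a::euclidean_space \<Rightarrow> real" and G :: "'a set"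
  assumes g[measurable]: "g \<in> borel_measurable borel" and g0: "\<And>z. 0 \<le> g z"
    and G[measurable]: "G \<in> sets borel"
begin

text \<open>Here m stands for the local maximal function at y, of which only two lower bounds
  matter: the value of g there and the average of radius \<open>r - l * dist x y\<close>. The error
  e differs between the three ranges of r, but its p-th power always fits under the same sum, so the
  supremum over r can be taken afterwards.\<close>

lemma havg_comparison:
  assumes p: "1 < p" and s: "0 < s" "s < 1" and \<epsilon>: "0 < \<epsilon>" "\<epsilon> < 1" and l: "1 \<le> l" and "x \<noteq> y"
    and r: "0 < r" "ball x r \<subseteq> G" and gy: "ennreal (g y) \<le> m"
    and conc: "0 < r - l * dist x y \<Longrightarrow>
      ball y (r - l * dist x y) \<subseteq> G \<and> havg g y (r - l * dist x y) \<le> m"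
  shows "\<exists>e. havg g x r \<le> m + e \<and> ennpowr e p \<le> ennreal (pointwise_const p DIM('a)) *
    (shift_term g G p x y + near_term g G p s x y + middle_term g G p \<epsilon> l x y + far_term g G p l x y)"
    (is "\<exists>e. _ \<and> _ \<le> ennreal ?C * ?Q")
proof -
  let ?n = "DIM('a)" and ?d = "dist x y"
  have d: "0 < ?d" using \<open>x \<noteq> y\<close> by simp
  note C = pointwise_const_bounds[where n = ?n and p = p]
  have C0: "0 \<le> ?C" using C(5) by linarith
  have le_Q: "shift_term g G p x y \<le> ?Q" "near_term g G p s x y \<le> ?Q"
    "middle_term g G p \<epsilon> l x y \<le> ?Q" "far_term g G p l x y \<le> ?Q"
    by (simp_all add: add_increasing add_increasing2)
  have point: "havg g x r \<le> m + havg (\<lambda>w. ennreal \<bar>g w - g y\<bar>) x r"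
    using havg_le_point[OF g g0 G r(1), of x y] gy by (meson add_right_mono order_trans)
  consider "r \<le> ?d" | "?d \<le> r" "r \<le> 2 * l * ?d" | "2 * l * ?d < r" by linarith
  then show ?thesis
  proof cases
    case 1
    let ?q = "real ?n / p + s"
    have q: "0 < ?q" using p s by (simp add: add_nonneg_pos)
    define e where "e = ennreal ((2 * ?d) powr ?q) * (ennreal (2 ^ ?n) * hlmax (hquot g G ?q y) x)"
    have "havg g x r \<le> m + e"
      using point havg_diff_le_hquot[OF g g0 G r(1) 1 r(2) q] unfolding e_def
      by (meson add_left_mono order_trans)
    moreover have "ennpowr e p \<le> ennreal ?C * near_term g G p s x y"
    proof -
      have "?q * p = real ?n + s * p" using p by (simp add: field_simps)
      then have "ennpowr e p = ennreal ((2 * ?d) powr (real ?n + s * p)) * (ennreal ((2 ^ ?n) powr p) * ennpowr (hlmax (hquot g G ?q y) x) p)"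
        by (simp add: e_def ennpowr_mult ennpowr_ennreal powr_powr)
      also have "(2 * ?d) powr (real ?n + s * p) = 2 powr (real ?n + s * p) * ?d powr (real ?n + s * p)"
        using d by (simp add: powr_mult)
      also have "ennreal (2 powr (real ?n + s * p) * ?d powr (real ?n + s * p)) * (ennreal ((2 ^ ?n) powr p) * ennpowr (hlmax (hquot g G ?q y) x) p)
         = ennreal (2 powr (real ?n + s * p) * (2 ^ ?n) powr p) * near_term g G p s x y"
        unfolding near_term_def by (simp add: ennreal_mult mult_ac)
      also have "\<dots> \<le> ennreal ?C * near_term g G p s x y"
      proof (intro mult_right_mono ennreal_leI)
        \<comment> \<open>Using s < 1 removes s from the constant.\<close>
        have "2 powr (real ?n + s * p) * (2 ^ ?n) powr p \<le> 2 powr (real ?n + p) * (2 ^ ?n) powr p"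
          using p s by (intro mult_right_mono powr_mono) auto
        then show "2 powr (real ?n + s * p) * (2 ^ ?n) powr p \<le> ?C" using C(1) by linarith
      qed simp
      finally show ?thesis .
    qed
    ultimately show ?thesis using le_Q(2) by (meson mult_left_mono order_trans zero_le)
  next
    case 2
    define e where "e = havg (\<lambda>w. ennreal \<bar>g w - g y\<bar>) x r"
    have "ennpowr e p \<le> ennreal (2 powr p) * havg (\<lambda>w. ennpowr (ennreal \<bar>g w - g y\<bar>) p) x r"
      unfolding e_def using p r(1) by (intro ennpowr_havg_le) simp_all
    also have "\<dots> \<le> ennreal (2 powr p) * (ennreal (2 ^ ?n / unit_ball_vol ?n) * middle_term g G p \<epsilon> l x y)"
      unfolding middle_term_def pdiff_def
      by (intro mult_left_mono havg_powr_le_weighted[OF g g0 G d 2 r(2) \<epsilon>]) simp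
    also have "\<dots> = ennreal (2 powr p * (2 ^ ?n / unit_ball_vol ?n)) * middle_term g G p \<epsilon> l x y"
      by (subst ennreal_mult) (simp_all add: mult.assoc)
    also have "\<dots> \<le> ennreal ?C * ?Q"
      using C(2) le_Q(3) by (intro mult_mono ennreal_leI) simp_all
    finally show ?thesis using point e_def by blast
  next
    case 3
    let ?h = "l * ?d"
    have "0 < ?h" using d l by simp
    moreover have "2 * ?h < r" using 3 by (simp add: mult.assoc)
    ultimately have h: "0 < ?h" "?h < r" "0 < r - ?h" by linarith+
    \<comment> \<open>Shrinking must precede shifting: about y only the ball of the reduced radius
      is known to lie in G.\<close>
    have sub: "ball y (r - ?h) \<subseteq> G" "ball x (r - ?h) \<subseteq> G"
      using conc[OF h(3)] r(2) subset_ball[of "r - ?h" r x] h by auto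
    define e1 where "e1 = ennreal (2 ^ ?n) * hlmax (tdiff g G (y - x)) x"
    define e2 where "e2 = ennreal (2 * 4 ^ ?n) * havg (\<lambda>w. hlmax (tdiff g G w) x) 0 (2 * ?h)"
    have "havg g x r \<le> havg g x (r - ?h) + e2"
      unfolding e2_def by (rule havg_le_concentric[OF g g0 G h(1,2) r(2)])
    also have "havg g x (r - ?h) \<le> havg g y (r - ?h) + e1"
      unfolding e1_def by (rule havg_le_shifted[OF g g0 G h(3) sub(2,1)])
    also have "havg g y (r - ?h) \<le> m" using conc[OF h(3)] by simp
    finally have "havg g x r \<le> m + (e1 + e2)" by (simp add: add.assoc add_mono)
    moreover have "ennpowr (e1 + e2) p \<le> ennreal ?C * ?Q"
    proof -
      have E1: "ennpowr e1 p = ennreal ((2 ^ ?n) powr p) * shift_term g G p x y"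
        by (simp add: e1_def shift_term_def ennpowr_mult ennpowr_ennreal)
      have "ennpowr e2 p = ennreal ((2 * 4 ^ ?n) powr p) * ennpowr (havg (\<lambda>w. hlmax (tdiff g G w) x) 0 (2 * ?h)) p"
        unfolding e2_def ennpowr_mult by (subst ennpowr_ennreal) simp_all
      also have "\<dots> \<le> ennreal ((2 * 4 ^ ?n) powr p) * (ennreal (2 powr p) * far_term g G p l x y)"
        unfolding far_term_def using p h(1)
        by (intro mult_left_mono ennpowr_havg_le measurable_hlmax_tdiff) simp_all
      also have "\<dots> = ennreal ((2 * 4 ^ ?n) powr p * 2 powr p) * far_term g G p l x y"
        by (subst ennreal_mult) (simp_all add: mult.assoc)
      finally have E2: "ennpowr e2 p \<le> ennreal ((2 * 4 ^ ?n) powr p * 2 powr p) * far_term g G p l x y" .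
      have "ennpowr (e1 + e2) p \<le> ennreal (2 powr p) * (ennpowr e1 p + ennpowr e2 p)"
        using p by (intro ennpowr_add_le) simp
      also have "\<dots> \<le> ennreal (2 powr p) * (ennreal ((2 ^ ?n) powr p) * shift_term g G p x y
          + ennreal ((2 * 4 ^ ?n) powr p * 2 powr p) * far_term g G p l x y)"
        unfolding E1 by (intro mult_left_mono add_left_mono E2) simp
      also have "\<dots> = ennreal (2 powr p * (2 ^ ?n) powr p) * shift_term g G p x y
          + ennreal (2 powr p * ((2 * 4 ^ ?n) powr p * 2 powr p)) * far_term g G p l x y"
        by (simp only: distrib_left mult.assoc[symmetric] ennreal_mult''[symmetric] powr_ge_zero mult_nonneg_nonneg)
      also have "\<dots> \<le> ennreal ?C * shift_term g G p x y + ennreal ?C * far_term g G p l x y"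
        using C(3,4) by (intro add_mono mult_right_mono ennreal_leI) simp_all
      also have "\<dots> = ennreal ?C * (shift_term g G p x y + far_term g G p l x y)"
        by (simp add: distrib_left)
      also have "\<dots> \<le> ennreal ?C * ?Q"
        by (intro mult_left_mono add_right_mono) (simp_all add: add.assoc add_increasing2)
      finally show ?thesis .
    qed
    ultimately show ?thesis by blast
  qed
qed

end

subsection \<open>Integral estimates\<close>

lemma nn_integral_difference_coords:
  fixes P :: "'a::euclidean_space \<Rightarrow> 'a \<Rightarrow> ennreal"
  assumes [measurable]: "(\<lambda>(w, x). P w x) \<in> borel_measurable (borel \<Otimes>\<^sub>M borel)"
  shows "(\<integral>\<^sup>+x. \<integral>\<^sup>+y. P (y - x) x \<partial>lborel \<partial>lborel) = (\<integral>\<^sup>+w. \<integral>\<^sup>+x. P w x \<partial>lborel \<partial>lborel)"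
proof -
  have [measurable]: "(\<lambda>w. P w x) \<in> borel_measurable borel" for x by measurable
  have m: "(\<lambda>(x, w). P w x) \<in> borel_measurable (lborel \<Otimes>\<^sub>M lborel)" by measurable
  have "(\<integral>\<^sup>+y. P (y - x) x \<partial>lborel) = (\<integral>\<^sup>+w. P w x \<partial>lborel)" for x
    using nn_integral_lborel_translate[of "\<lambda>w. P w x" "- x"] by simp
  then show ?thesis using lborel_pair.Fubini'[OF m] by simp
qed

lemma measurable_pdiff [measurable]:
  fixes g :: "'a::euclidean_space \<Rightarrow> real"
  assumes [measurable]: "g \<in> borel_measurable borel"
    and [measurable]: "X \<in> borel_measurable M" "Y \<in> borel_measurable M"
  shows "(\<lambda>v. pdiff g p (X v) (Y v)) \<in> borel_measurable M"
  unfolding pdiff_def by measurable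

lemma measurable_skernel [measurable]: "skernel b \<in> borel_measurable borel"
  unfolding skernel_def by measurable

lemma skernel_commute: "skernel b (x - y) = skernel b (y - x)"
  by (simp add: skernel_def norm_minus_commute)

definition hlconst :: "real \<Rightarrow> nat \<Rightarrow> real" where
  "hlconst p n = 5 ^ n * 2 powr p * p / (p - 1)"

text \<open>Here b is the guaranteed decay beyond the dimension; it is taken to be \<epsilon> or n,
  never s*p.\<close>

definition tailconst :: "real \<Rightarrow> nat \<Rightarrow> real" where
  "tailconst b n = unit_ball_vol n * 2 ^ n / (1 - 2 powr - b)"

lemma powr_divide_minus:
  fixes a b t :: real
  assumes "0 \<le> a" "0 < b"
  shows "(a / b) powr - t = a powr - t * b powr t"
  using assms by (simp add: powr_divide powr_minus_divide)

lemma tailconst_nonneg: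
  assumes "0 < b" shows "0 \<le> tailconst b n"
proof -
  have "2 powr - b \<le> (2::real) powr 0" using assms by (intro powr_mono) auto
  then show ?thesis unfolding tailconst_def by (intro divide_nonneg_nonneg) auto
qed

lemma nn_integral_tail_dist:
  fixes y :: "'a::euclidean_space"
  assumes "0 < b0" "b0 \<le> b" "0 < a"
  shows "(\<integral>\<^sup>+x. ennreal (dist x y powr - (real DIM('a) + b)) * indicator {x. a \<le> dist x y} x \<partial>lborel)
    \<le> ennreal (tailconst b0 DIM('a) * a powr - b)"
proof -
  have "(\<integral>\<^sup>+x. ennreal (dist x y powr - (real DIM('a) + b)) * indicator {x. a \<le> dist x y} x \<partial>lborel)
    = (\<integral>\<^sup>+x. ennreal (norm (- y + x) powr - (real DIM('a) + b)) * indicator {u. a \<le> norm u} (- y + x) \<partial>lborel)"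
    by (intro nn_integral_cong) (simp add: dist_norm indicator_def)
  also have "\<dots> = (\<integral>\<^sup>+(u::'a). ennreal (norm u powr - (real DIM('a) + b)) * indicator {u. a \<le> norm u} u \<partial>lborel)"
    by (rule nn_integral_lborel_translate) measurable
  also have "\<dots> \<le> ennreal (tailconst b0 DIM('a) * a powr - b)"
    unfolding tailconst_def by (rule nn_integral_tail_powr[OF assms])
  finally show ?thesis .
qed

context
  fixes g :: "'a::euclidean_space \<Rightarrow> real" and G :: "'a set" and p s :: real
  assumes g[measurable]: "g \<in> borel_measurable borel"
    and G[measurable]: "G \<in> sets borel" and p: "1 < p" and s: "0 < s" "s < 1"
begin

abbreviation energy :: ennreal where
  "energy \<equiv> (\<integral>\<^sup>+x\<in>G. (\<integral>\<^sup>+y\<in>G. pdiff g p x y * skernel (s * p) (x - y) \<partial>lborel) \<partial>lborel)"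

lemma measurable_shift_term:
  assumes [measurable]: "X \<in> borel_measurable M" "Y \<in> borel_measurable M"
  shows "(\<lambda>v. ennpowr (hlmax (tdiff g G (X v)) (Y v)) p) \<in> borel_measurable M"
  by (rule measurable_compose[OF measurable_hlmax_tdiff measurable_ennpowr]) simp_all

text \<open>For a fixed shift w the kernel is constant in x, so the strong type bound applies in x;
  the substitution y = x + w then recovers the double integral over G x G. Both the shift and the
  far term rest on this.\<close>

lemma hlmax_shift_integral_le:
  "(\<integral>\<^sup>+w. \<integral>\<^sup>+x. ennpowr (hlmax (tdiff g G w) x) p * skernel (s * p) w \<partial>lborel \<partial>lborel)
    \<le> ennreal (hlconst p DIM('a)) * energy"
proof -
  note [measurable] = measurable_shift_term
  have m: "(\<lambda>(w, x). ennpowr (tdiff g G w x) p * skernel (s * p) w) \<in> borel_measurable (borel \<Otimes>\<^sub>M borel)"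
    by measurable
  have "(\<integral>\<^sup>+w. \<integral>\<^sup>+x. ennpowr (hlmax (tdiff g G w) x) p * skernel (s * p) w \<partial>lborel \<partial>lborel)
    \<le> (\<integral>\<^sup>+w. ennreal (hlconst p DIM('a)) * (\<integral>\<^sup>+x. ennpowr (tdiff g G w x) p * skernel (s * p) w \<partial>lborel) \<partial>lborel)"
  proof (rule nn_integral_mono)
    fix w
    have "(\<integral>\<^sup>+x. ennpowr (hlmax (tdiff g G w) x) p * skernel (s * p) w \<partial>lborel)
      = (\<integral>\<^sup>+x. ennpowr (hlmax (tdiff g G w) x) p \<partial>lborel) * skernel (s * p) w"
      by (rule nn_integral_multc) measurable
    also have "\<dots> \<le> (ennreal (hlconst p DIM('a)) * (\<integral>\<^sup>+x. ennpowr (tdiff g G w x) p \<partial>lborel)) * skernel (s * p) w"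
      unfolding hlconst_def by (intro mult_right_mono hlmax_strong_type p) simp_all
    also have "\<dots> = ennreal (hlconst p DIM('a)) * (\<integral>\<^sup>+x. ennpowr (tdiff g G w x) p * skernel (s * p) w \<partial>lborel)"
      by (subst nn_integral_multc) (simp_all add: mult.assoc)
    finally show "(\<integral>\<^sup>+x. ennpowr (hlmax (tdiff g G w) x) p * skernel (s * p) w \<partial>lborel)
      \<le> ennreal (hlconst p DIM('a)) * (\<integral>\<^sup>+x. ennpowr (tdiff g G w x) p * skernel (s * p) w \<partial>lborel)" .
  qed
  also have "\<dots> = ennreal (hlconst p DIM('a)) * (\<integral>\<^sup>+w. \<integral>\<^sup>+x. ennpowr (tdiff g G w x) p * skernel (s * p) w \<partial>lborel \<partial>lborel)"
    by (rule nn_integral_cmult) measurable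
  also have "(\<integral>\<^sup>+w. \<integral>\<^sup>+x. ennpowr (tdiff g G w x) p * skernel (s * p) w \<partial>lborel \<partial>lborel)
    = (\<integral>\<^sup>+x. \<integral>\<^sup>+y. ennpowr (tdiff g G (y - x) x) p * skernel (s * p) (y - x) \<partial>lborel \<partial>lborel)"
    by (rule nn_integral_difference_coords[OF m, symmetric])
  also have "\<dots> = energy"
  proof -
    have "ennpowr (tdiff g G (y - x) x) p * skernel (s * p) (y - x)
      = pdiff g p x y * skernel (s * p) (x - y) * indicator G y * indicator G x" for x y
      by (auto simp: tdiff_def pdiff_def indicator_def skernel_commute[of _ x y])
    then show ?thesis by (simp add: nn_integral_multc)
  qed
  finally show ?thesis .
qed

lemma shift_term_integral_le:
  "(\<integral>\<^sup>+x. \<integral>\<^sup>+y. shift_term g G p x y * skernel (s * p) (x - y) \<partial>lborel \<partial>lborel)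
    \<le> ennreal (hlconst p DIM('a)) * energy"
proof -
  note [measurable] = measurable_shift_term
  have m: "(\<lambda>(w, x). ennpowr (hlmax (tdiff g G w) x) p * skernel (s * p) w) \<in> borel_measurable (borel \<Otimes>\<^sub>M borel)"
    by measurable
  show ?thesis
    using hlmax_shift_integral_le
    unfolding nn_integral_difference_coords[OF m, symmetric] shift_term_def
    by (subst skernel_commute)
qed

lemma energy_commute:
  "energy = (\<integral>\<^sup>+y\<in>G. (\<integral>\<^sup>+x\<in>G. pdiff g p x y * skernel (s * p) (x - y) \<partial>lborel) \<partial>lborel)"
proof -
  have "pdiff g p x y * skernel (s * p) (x - y) = pdiff g p y x * skernel (s * p) (y - x)" for x y
    by (simp add: pdiff_def abs_minus_commute skernel_commute[of _ x y])
  then show ?thesis by simp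
qed

text \<open>With y fixed the kernel cancels, the strong type bound acts in x, and the p-th power of
  the difference quotient is again the integrand of the seminorm.\<close>

lemma near_term_integral_le:
  "(\<integral>\<^sup>+y\<in>G. (\<integral>\<^sup>+x. near_term g G p s x y * skernel (s * p) (x - y) \<partial>lborel) \<partial>lborel)
    \<le> ennreal (hlconst p DIM('a)) * energy"
proof -
  let ?q = "real DIM('a) / p + s"
  have "(\<integral>\<^sup>+x. near_term g G p s x y * skernel (s * p) (x - y) \<partial>lborel)
    \<le> ennreal (hlconst p DIM('a)) * (\<integral>\<^sup>+x\<in>G. pdiff g p x y * skernel (s * p) (x - y) \<partial>lborel)" for y
  proof -
    have "near_term g G p s x y * skernel (s * p) (x - y) \<le> ennpowr (hlmax (hquot g G ?q y) x) p" for x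
    proof (cases "x = y")
      case False
      then have "ennreal (dist x y powr (real DIM('a) + s * p)) * skernel (s * p) (x - y) = 1"
        by (simp add: skernel_def dist_norm flip: ennreal_mult powr_add)
      then have "ennreal (dist x y powr (real DIM('a) + s * p)) * skernel (s * p) (x - y) * ennpowr (hlmax (hquot g G ?q y) x) p = ennpowr (hlmax (hquot g G ?q y) x) p"
        by simp
      then show ?thesis by (simp add: near_term_def mult_ac)
    qed (simp add: near_term_def)
    then have "(\<integral>\<^sup>+x. near_term g G p s x y * skernel (s * p) (x - y) \<partial>lborel)
      \<le> (\<integral>\<^sup>+x. ennpowr (hlmax (hquot g G ?q y) x) p \<partial>lborel)"
      by (intro nn_integral_mono)
    also have "\<dots> \<le> ennreal (hlconst p DIM('a)) * (\<integral>\<^sup>+x. ennpowr (hquot g G ?q y x) p \<partial>lborel)"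
      unfolding hlconst_def by (intro hlmax_strong_type p) simp
    also have "(\<integral>\<^sup>+x. ennpowr (hquot g G ?q y x) p \<partial>lborel) = (\<integral>\<^sup>+x\<in>G. pdiff g p x y * skernel (s * p) (x - y) \<partial>lborel)"
    proof (rule nn_integral_cong)
      fix x
      have q: "- ?q * p = - (real DIM('a) + s * p)" using p by (simp add: field_simps)
      have "ennpowr (hquot g G ?q y x) p = ennpowr (ennreal \<bar>g x - g y\<bar> * ennreal (norm (x - y) powr - ?q)) p * indicator G x"
        by (auto simp: hquot_def ennreal_mult' indicator_def)
      also have "\<dots> = pdiff g p x y * ennreal (norm (x - y) powr (- ?q * p)) * indicator G x"
        by (simp add: ennpowr_mult pdiff_def ennpowr_ennreal powr_powr)
      finally show "ennpowr (hquot g G ?q y x) p = pdiff g p x y * skernel (s * p) (x - y) * indicator G x"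
        unfolding q skernel_def .
    qed
    finally show ?thesis .
  qed
  then have "(\<integral>\<^sup>+y\<in>G. (\<integral>\<^sup>+x. near_term g G p s x y * skernel (s * p) (x - y) \<partial>lborel) \<partial>lborel)
    \<le> (\<integral>\<^sup>+y\<in>G. (ennreal (hlconst p DIM('a)) * (\<integral>\<^sup>+x\<in>G. pdiff g p x y * skernel (s * p) (x - y) \<partial>lborel)) \<partial>lborel)"
    by (intro nn_integral_mono mult_right_mono) auto
  also have "\<dots> = ennreal (hlconst p DIM('a)) * (\<integral>\<^sup>+y\<in>G. (\<integral>\<^sup>+x\<in>G. pdiff g p x y * skernel (s * p) (x - y) \<partial>lborel) \<partial>lborel)"
    by (subst nn_integral_cmult[symmetric]) (simp_all add: mult.assoc)
  finally show ?thesis unfolding energy_commute .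
qed

text \<open>Integrating in x first, the cutoff reads
  \<open>dist x y >= norm (w - y) / (4 * l)\<close> and the tail decays with excess \<epsilon> +
  s*p. The tail integral gives (4l)^(\<epsilon>+s*p) times a power of \<open>norm (w - y)\<close>
  that combines with the weight to the original kernel.\<close>

lemma middle_term_integral_le:
  assumes \<epsilon>: "0 < \<epsilon>" "\<epsilon> < 1" and l: "1 \<le> l"
  shows "(\<integral>\<^sup>+y\<in>G. (\<integral>\<^sup>+x. middle_term g G p \<epsilon> l x y * skernel (s * p) (x - y) \<partial>lborel) \<partial>lborel)
    \<le> ennreal (tailconst \<epsilon> DIM('a) * 4 powr (p + 1) * l powr (\<epsilon> + s * p)) * energy"
proof -
  let ?n = "real DIM('a)"
  let ?C = "tailconst \<epsilon> DIM('a) * 4 powr (p + 1) * l powr (\<epsilon> + s * p)"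
  have inner: "(\<integral>\<^sup>+x. ennreal (norm (w - y) powr (\<epsilon> - ?n) * dist x y powr - \<epsilon> *
        indicator {w. norm (w - y) \<le> 2 * (2 * l * dist x y)} w) * skernel (s * p) (x - y) \<partial>lborel)
      \<le> ennreal ?C * skernel (s * p) (w - y)" for w y :: 'a
  proof (cases "w = y")
    case False
    let ?a = "norm (w - y) / (4 * l)"
    have a: "0 < ?a" using False l by simp
    have "(\<integral>\<^sup>+x. ennreal (norm (w - y) powr (\<epsilon> - ?n) * dist x y powr - \<epsilon> *
        indicator {w. norm (w - y) \<le> 2 * (2 * l * dist x y)} w) * skernel (s * p) (x - y) \<partial>lborel)
      = (\<integral>\<^sup>+x. ennreal (norm (w - y) powr (\<epsilon> - ?n)) *
          (ennreal (dist x y powr - (?n + (\<epsilon> + s * p))) * indicator {x. ?a \<le> dist x y} x) \<partial>lborel)"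
    proof (rule nn_integral_cong)
      fix x
      have i: "norm (w - y) \<le> 2 * (2 * l * dist x y) \<longleftrightarrow> ?a \<le> dist x y"
        using l by (simp add: field_simps)
      have "dist x y powr - \<epsilon> * norm (x - y) powr - (?n + s * p) = dist x y powr - (?n + (\<epsilon> + s * p))"
        by (simp add: dist_norm powr_add[symmetric] algebra_simps)
      then show "ennreal (norm (w - y) powr (\<epsilon> - ?n) * dist x y powr - \<epsilon> *
        indicator {w. norm (w - y) \<le> 2 * (2 * l * dist x y)} w) * skernel (s * p) (x - y)
        = ennreal (norm (w - y) powr (\<epsilon> - ?n)) *
          (ennreal (dist x y powr - (?n + (\<epsilon> + s * p))) * indicator {x. ?a \<le> dist x y} x)"
        unfolding indicator_def mem_Collect_eq i
        by (cases "?a \<le> dist x y") (simp_all add: skernel_def mult.assoc flip: ennreal_mult)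
    qed
    also have "\<dots> = ennreal (norm (w - y) powr (\<epsilon> - ?n)) *
       (\<integral>\<^sup>+x. ennreal (dist x y powr - (?n + (\<epsilon> + s * p))) * indicator {x. ?a \<le> dist x y} x \<partial>lborel)"
      by (rule nn_integral_cmult) measurable
    also have "\<dots> \<le> ennreal (norm (w - y) powr (\<epsilon> - ?n)) * ennreal (tailconst \<epsilon> DIM('a) * ?a powr - (\<epsilon> + s * p))"
      using \<epsilon> s p a by (intro mult_left_mono nn_integral_tail_dist) auto
    also have "\<dots> = ennreal (norm (w - y) powr (\<epsilon> - ?n) * (tailconst \<epsilon> DIM('a) * ?a powr - (\<epsilon> + s * p)))"
      by (rule ennreal_mult'[symmetric]) simp
    also have "\<dots> \<le> ennreal (?C * norm (w - y) powr - (?n + s * p))"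
    proof (rule ennreal_leI)
      have t: "0 \<le> tailconst \<epsilon> DIM('a)"
        using \<epsilon> by (intro tailconst_nonneg)
      have "?a powr - (\<epsilon> + s * p) = norm (w - y) powr - (\<epsilon> + s * p) * (4 * l) powr (\<epsilon> + s * p)"
        using l by (intro powr_divide_minus) auto
      also have "\<dots> = norm (w - y) powr - (\<epsilon> + s * p) * (4 powr (\<epsilon> + s * p) * l powr (\<epsilon> + s * p))"
        using l by (simp add: powr_mult)
      also have "\<dots> \<le> norm (w - y) powr - (\<epsilon> + s * p) * (4 powr (p + 1) * l powr (\<epsilon> + s * p))"
      proof -
        \<comment> \<open>Bounds the power of 4 independently of s.\<close>
        have "s * p \<le> p" using s p by simp
        then have "4 powr (\<epsilon> + s * p) \<le> 4 powr (p + 1)" using \<epsilon> by (intro powr_mono) auto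
        then show ?thesis by (intro mult_left_mono mult_right_mono) auto
      qed
      finally have "norm (w - y) powr (\<epsilon> - ?n) * (tailconst \<epsilon> DIM('a) * ?a powr - (\<epsilon> + s * p))
        \<le> norm (w - y) powr (\<epsilon> - ?n) * (tailconst \<epsilon> DIM('a) * (norm (w - y) powr - (\<epsilon> + s * p) * (4 powr (p + 1) * l powr (\<epsilon> + s * p))))"
        using t by (intro mult_left_mono) auto
      also have "\<dots> = ?C * (norm (w - y) powr (\<epsilon> - ?n) * norm (w - y) powr - (\<epsilon> + s * p))"
        by (simp add: mult_ac)
      also have "norm (w - y) powr (\<epsilon> - ?n) * norm (w - y) powr - (\<epsilon> + s * p) = norm (w - y) powr - (?n + s * p)"
        by (simp flip: powr_add)
      finally show "norm (w - y) powr (\<epsilon> - ?n) * (tailconst \<epsilon> DIM('a) * ?a powr - (\<epsilon> + s * p)) \<le> ?C * norm (w - y) powr - (?n + s * p)" .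
    qed
    also have "\<dots> = ennreal ?C * skernel (s * p) (w - y)"
      unfolding skernel_def by (rule ennreal_mult'') simp
    finally show ?thesis .
  qed simp
  have "(\<integral>\<^sup>+x. middle_term g G p \<epsilon> l x y * skernel (s * p) (x - y) \<partial>lborel)
    \<le> ennreal ?C * (\<integral>\<^sup>+w\<in>G. pdiff g p w y * skernel (s * p) (w - y) \<partial>lborel)" for y
  proof -
    let ?W = "\<lambda>w x. ennreal (norm (w - y) powr (\<epsilon> - ?n) * dist x y powr - \<epsilon> *
        indicator {w. norm (w - y) \<le> 2 * (2 * l * dist x y)} w)"
    have W[measurable]: "(\<lambda>(x, w). ?W w x) \<in> borel_measurable (borel \<Otimes>\<^sub>M borel)"
      unfolding indicator_def by measurable
    have [measurable]: "(\<lambda>w. ?W w x) \<in> borel_measurable borel" "(\<lambda>x. ?W w x) \<in> borel_measurable borel" for x w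
      unfolding indicator_def by measurable
    have m: "(\<lambda>(x, w). pdiff g p w y * ?W w x * indicator G w * skernel (s * p) (x - y)) \<in> borel_measurable (lborel \<Otimes>\<^sub>M lborel)"
      by measurable
    have "(\<integral>\<^sup>+x. middle_term g G p \<epsilon> l x y * skernel (s * p) (x - y) \<partial>lborel)
      = (\<integral>\<^sup>+x. \<integral>\<^sup>+w. pdiff g p w y * ?W w x * indicator G w * skernel (s * p) (x - y) \<partial>lborel \<partial>lborel)"
      unfolding middle_term_def by (intro nn_integral_cong nn_integral_multc[symmetric]) measurable
    also have "\<dots> = (\<integral>\<^sup>+w. \<integral>\<^sup>+x. pdiff g p w y * ?W w x * indicator G w * skernel (s * p) (x - y) \<partial>lborel \<partial>lborel)"
      by (rule lborel_pair.Fubini'[OF m, symmetric])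
    also have "\<dots> = (\<integral>\<^sup>+w. (pdiff g p w y * indicator G w) * (\<integral>\<^sup>+x. ?W w x * skernel (s * p) (x - y) \<partial>lborel) \<partial>lborel)"
      by (subst nn_integral_cmult[symmetric]) (simp_all add: mult_ac)
    also have "\<dots> \<le> (\<integral>\<^sup>+w. (pdiff g p w y * indicator G w) * (ennreal ?C * skernel (s * p) (w - y)) \<partial>lborel)"
      by (intro nn_integral_mono mult_left_mono inner) simp
    also have "\<dots> = ennreal ?C * (\<integral>\<^sup>+w\<in>G. pdiff g p w y * skernel (s * p) (w - y) \<partial>lborel)"
      by (subst nn_integral_cmult[symmetric]) (simp_all add: mult_ac)
    finally show ?thesis .
  qed
  then have "(\<integral>\<^sup>+y\<in>G. (\<integral>\<^sup>+x. middle_term g G p \<epsilon> l x y * skernel (s * p) (x - y) \<partial>lborel) \<partial>lborel)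
    \<le> (\<integral>\<^sup>+y\<in>G. (ennreal ?C * (\<integral>\<^sup>+x\<in>G. pdiff g p x y * skernel (s * p) (x - y) \<partial>lborel)) \<partial>lborel)"
    by (intro nn_integral_mono mult_right_mono) auto
  also have "\<dots> = ennreal ?C * (\<integral>\<^sup>+y\<in>G. (\<integral>\<^sup>+x\<in>G. pdiff g p x y * skernel (s * p) (x - y) \<partial>lborel) \<partial>lborel)"
    by (subst nn_integral_cmult[symmetric]) (simp_all add: mult.assoc)
  finally show ?thesis unfolding energy_commute .
qed

text \<open>The normalisation contributes (2 * l * dist x y)^(-n). Integrating in y over
  \<open>dist x y > norm w / (2 * l)\<close> produces (2l)^(n+s*p) times the kernel at w, and (2l)^n
  cancels: only l^(s*p) remains. The rest is \<open>hlmax_shift_integral_le\<close>.\<close>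

lemma far_term_integral_le:
  assumes l: "1 \<le> l"
  shows "(\<integral>\<^sup>+x. \<integral>\<^sup>+y. far_term g G p l x y * skernel (s * p) (x - y) \<partial>lborel \<partial>lborel)
    \<le> ennreal (tailconst DIM('a) DIM('a) / unit_ball_vol DIM('a) * 2 powr p * l powr (s * p)) *
      (ennreal (hlconst p DIM('a)) * energy)"
proof -
  note [measurable] = measurable_shift_term
  let ?n = "real DIM('a)" and ?v = "unit_ball_vol (real DIM('a))"
  let ?C = "tailconst ?n DIM('a) / ?v * 2 powr p * l powr (s * p)"
  let ?E = "\<lambda>w x. ennpowr (hlmax (tdiff g G w) x) p"
  let ?W = "\<lambda>w x y. ennreal (1 / (?v * (2 * (l * dist x y)) powr ?n)) * indicator {w. norm w < 2 * (l * dist x y)} w * skernel (s * p) (x - y)"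
  have inner: "(\<integral>\<^sup>+y. ?W w x y \<partial>lborel) \<le> ennreal ?C * skernel (s * p) w" if "w \<noteq> 0" for w x :: 'a
  proof -
    let ?a = "norm w / (2 * l)"
    have a: "0 < ?a" using that l by simp
    have "(\<integral>\<^sup>+y. ?W w x y \<partial>lborel)
      \<le> (\<integral>\<^sup>+y. ennreal (1 / (?v * (2 * l) powr ?n)) * (ennreal (dist y x powr - (?n + (?n + s * p))) * indicator {y. ?a \<le> dist y x} y) \<partial>lborel)"
    proof (rule nn_integral_mono)
      fix y
      show "?W w x y \<le> ennreal (1 / (?v * (2 * l) powr ?n)) * (ennreal (dist y x powr - (?n + (?n + s * p))) * indicator {y. ?a \<le> dist y x} y)"
      proof (cases "norm w < 2 * (l * dist x y)")
        case True
        then have "?a \<le> dist y x" using l by (simp add: field_simps dist_commute)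
        moreover have "1 / (?v * (2 * (l * dist x y)) powr ?n) * norm (x - y) powr - (?n + s * p)
          = 1 / (?v * (2 * l) powr ?n) * dist y x powr - (?n + (?n + s * p))"
        proof -
          have "(2 * (l * dist x y)) powr ?n = (2 * l) powr ?n * dist x y powr ?n"
            using l by (simp add: powr_mult mult.assoc)
          moreover have "norm (x - y) powr - (?n + s * p) = dist y x powr - (?n + (?n + s * p)) * dist x y powr ?n"
            by (simp add: dist_norm norm_minus_commute powr_add[symmetric])
          moreover have "0 < dist x y powr ?n"
          proof -
            have "0 < l * dist x y" using True norm_ge_zero[of w] by linarith
            then show ?thesis by auto
          qed
          ultimately show ?thesis by simp
        qed
        ultimately show ?thesis
          using True by (simp add: skernel_def flip: ennreal_mult)
      qed simp
    qed
    also have "\<dots> = ennreal (1 / (?v * (2 * l) powr ?n)) *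
       (\<integral>\<^sup>+y. ennreal (dist y x powr - (?n + (?n + s * p))) * indicator {y. ?a \<le> dist y x} y \<partial>lborel)"
      by (rule nn_integral_cmult) measurable
    also have "\<dots> \<le> ennreal (1 / (?v * (2 * l) powr ?n)) * ennreal (tailconst ?n DIM('a) * ?a powr - (?n + s * p))"
      using s p a by (intro mult_left_mono nn_integral_tail_dist) auto
    also have "\<dots> = ennreal (1 / (?v * (2 * l) powr ?n) * (tailconst ?n DIM('a) * ?a powr - (?n + s * p)))"
      by (rule ennreal_mult'[symmetric]) simp
    also have "\<dots> \<le> ennreal (?C * norm w powr - (?n + s * p))"
    proof (rule ennreal_leI)
      have t: "0 \<le> tailconst ?n DIM('a)"
        by (intro tailconst_nonneg) simp
      have "?a powr - (?n + s * p) = norm w powr - (?n + s * p) * (2 * l) powr (?n + s * p)"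
        using l by (intro powr_divide_minus) auto
      also have "(2 * l) powr (?n + s * p) = (2 * l) powr ?n * (2 powr (s * p) * l powr (s * p))"
        using l by (simp add: powr_add powr_mult)
      finally have "1 / (?v * (2 * l) powr ?n) * (tailconst ?n DIM('a) * ?a powr - (?n + s * p))
        = tailconst ?n DIM('a) / ?v * 2 powr (s * p) * l powr (s * p) * norm w powr - (?n + s * p)"
        using l by simp
      also have "\<dots> \<le> ?C * norm w powr - (?n + s * p)"
      proof -
        have "2 powr (s * p) \<le> 2 powr p" using s p by (intro powr_mono) auto
        then show ?thesis using t by (intro mult_right_mono mult_left_mono) auto
      qed
      finally show "1 / (?v * (2 * l) powr ?n) * (tailconst ?n DIM('a) * ?a powr - (?n + s * p)) \<le> ?C * norm w powr - (?n + s * p)" .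
    qed
    also have "\<dots> = ennreal ?C * skernel (s * p) w"
      unfolding skernel_def by (rule ennreal_mult'') simp
    finally show ?thesis .
  qed
  have mW: "(\<lambda>v. ?W (X v) (Y v) (Z v)) \<in> borel_measurable M"
    if [measurable]: "X \<in> borel_measurable M" "Y \<in> borel_measurable M" "Z \<in> borel_measurable M" for X Y Z and M :: "'c measure"
    unfolding indicator_def by measurable
  have "(\<integral>\<^sup>+y. far_term g G p l x y * skernel (s * p) (x - y) \<partial>lborel)
    \<le> (\<integral>\<^sup>+w. ?E w x * (ennreal ?C * skernel (s * p) w) \<partial>lborel)" for x
  proof -
    have "(\<integral>\<^sup>+y. far_term g G p l x y * skernel (s * p) (x - y) \<partial>lborel)
      = (\<integral>\<^sup>+y. \<integral>\<^sup>+w. ?E w x * ?W w x y \<partial>lborel \<partial>lborel)"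
    proof (rule nn_integral_cong)
      fix y
      show "far_term g G p l x y * skernel (s * p) (x - y) = (\<integral>\<^sup>+w. ?E w x * ?W w x y \<partial>lborel)"
      proof (cases "x = y")
        case False
        have h: "0 < 2 * (l * dist x y)" using False l by simp
        have "far_term g G p l x y * skernel (s * p) (x - y)
          = ennreal (1 / (?v * (2 * (l * dist x y)) powr ?n)) * (\<integral>\<^sup>+w. ?E w x * indicator (ball 0 (2 * (l * dist x y))) w \<partial>lborel) * skernel (s * p) (x - y)"
          unfolding far_term_def havg_eq[OF h] powr_realpow[OF h] ..
        also have "\<dots> = (ennreal (1 / (?v * (2 * (l * dist x y)) powr ?n)) * skernel (s * p) (x - y)) * (\<integral>\<^sup>+w. ?E w x * indicator (ball 0 (2 * (l * dist x y))) w \<partial>lborel)"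
          by (simp only: mult_ac)
        also have "\<dots> = (\<integral>\<^sup>+w. (ennreal (1 / (?v * (2 * (l * dist x y)) powr ?n)) * skernel (s * p) (x - y)) * (?E w x * indicator (ball 0 (2 * (l * dist x y))) w) \<partial>lborel)"
          by (rule nn_integral_cmult[symmetric]) measurable
        also have "\<dots> = (\<integral>\<^sup>+w. ?E w x * ?W w x y \<partial>lborel)"
          by (intro nn_integral_cong) (auto simp: indicator_def mult_ac)
        finally show ?thesis .
      qed (simp add: skernel_def)
    qed
    also have "\<dots> = (\<integral>\<^sup>+w. \<integral>\<^sup>+y. ?E w x * ?W w x y \<partial>lborel \<partial>lborel)"
    proof (rule lborel_pair.Fubini'[symmetric])
      show "(\<lambda>(y, w). ?E w x * ?W w x y) \<in> borel_measurable (lborel \<Otimes>\<^sub>M lborel)"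
        using mW[of snd "lborel \<Otimes>\<^sub>M lborel" "\<lambda>_. x" fst] unfolding case_prod_beta
        by (intro borel_measurable_times_ennreal measurable_shift_term) simp_all
    qed
    also have "\<dots> = (\<integral>\<^sup>+w. ?E w x * (\<integral>\<^sup>+y. ?W w x y \<partial>lborel) \<partial>lborel)"
      using mW[of "\<lambda>_. _" lborel "\<lambda>_. x" "\<lambda>y. y"]
      by (intro nn_integral_cong nn_integral_cmult) simp
    also have "\<dots> \<le> (\<integral>\<^sup>+w. ?E w x * (ennreal ?C * skernel (s * p) w) \<partial>lborel)"
    \<comment> \<open>The point w = 0, where the kernel on the right is 0 by the convention for
      \<open>powr\<close>, is discarded as a null set.\<close>
    proof (rule nn_integral_mono_AE)
      show "AE w in lborel. ?E w x * (\<integral>\<^sup>+y. ?W w x y \<partial>lborel) \<le> ?E w x * (ennreal ?C * skernel (s * p) w)"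
        using AE_lborel_singleton[of "0::'a"]
        by eventually_elim (intro mult_left_mono inner, simp_all)
    qed
    finally show ?thesis .
  qed
  then have "(\<integral>\<^sup>+x. \<integral>\<^sup>+y. far_term g G p l x y * skernel (s * p) (x - y) \<partial>lborel \<partial>lborel)
    \<le> (\<integral>\<^sup>+x. \<integral>\<^sup>+w. ?E w x * (ennreal ?C * skernel (s * p) w) \<partial>lborel \<partial>lborel)"
    by (rule nn_integral_mono)
  also have "\<dots> = (\<integral>\<^sup>+w. \<integral>\<^sup>+x. ?E w x * (ennreal ?C * skernel (s * p) w) \<partial>lborel \<partial>lborel)"
    by (rule lborel_pair.Fubini'[symmetric]) measurable
  also have "\<dots> = (\<integral>\<^sup>+w. \<integral>\<^sup>+x. ennreal ?C * (?E w x * skernel (s * p) w) \<partial>lborel \<partial>lborel)"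
    by (simp only: mult_ac)
  also have "\<dots> = (\<integral>\<^sup>+w. ennreal ?C * (\<integral>\<^sup>+x. ?E w x * skernel (s * p) w \<partial>lborel) \<partial>lborel)"
    by (intro nn_integral_cong nn_integral_cmult) measurable
  also have "\<dots> = ennreal ?C * (\<integral>\<^sup>+w. \<integral>\<^sup>+x. ?E w x * skernel (s * p) w \<partial>lborel \<partial>lborel)"
    by (rule nn_integral_cmult) measurable
  also have "\<dots> \<le> ennreal ?C * (ennreal (hlconst p DIM('a)) * energy)"
    by (intro mult_left_mono hlmax_shift_integral_le) simp
  finally show ?thesis .
qed

end

section \<open>Integration of the combined error against the kernel on G x G\<close>

definition total_term :: "('a::euclidean_space \<Rightarrow> real) \<Rightarrow> 'a set \<Rightarrow> real \<Rightarrow> real \<Rightarrow> real \<Rightarrow> real \<Rightarrow> 'a \<Rightarrow> 'a \<Rightarrow> ennreal" where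
  "total_term g G p s \<epsilon> l x y = pdiff g p x y +
     (shift_term g G p x y + near_term g G p s x y + middle_term g G p \<epsilon> l x y + far_term g G p l x y)"

text \<open>The 1 belongs to \<open>pdiff\<close>, the two copies of \<open>hlconst\<close> to the
  shift and near terms, the remaining summands to the middle and far terms. Smaller powers of l are
  raised to l^(\<epsilon>+s*p), which is possible as l >= 1.\<close>

definition integral_const :: "real \<Rightarrow> real \<Rightarrow> nat \<Rightarrow> real" where
  "integral_const p \<epsilon> n = 1 + 2 * hlconst p n + tailconst \<epsilon> n * 4 powr (p + 1)
     + tailconst n n / unit_ball_vol n * 2 powr p * hlconst p n"

definition skernel_on :: "'a::euclidean_space set \<Rightarrow> real \<Rightarrow> 'a \<Rightarrow> 'a \<Rightarrow> ennreal" where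
  "skernel_on G b x y = skernel b (x - y) * indicator G x * indicator G y"

lemma skernel_on_commute: "skernel_on G b x y = skernel_on G b y x"
  by (simp add: skernel_on_def skernel_commute[of _ x y] mult_ac)

lemma measurable_skernel_on:
  assumes [measurable]: "G \<in> sets borel"
  shows "(\<lambda>(x, y). skernel_on G b x y) \<in> borel_measurable (borel \<Otimes>\<^sub>M borel)"
  unfolding skernel_on_def by measurable

context
  fixes g :: "'a::euclidean_space \<Rightarrow> real" and G :: "'a set" and p s \<epsilon> l :: real
  assumes g[measurable]: "g \<in> borel_measurable borel"
    and G[measurable]: "G \<in> sets borel" and p: "1 < p" and s: "0 < s" "s < 1"
    and \<epsilon>: "0 < \<epsilon>" "\<epsilon> < 1" and l: "1 \<le> l"
begin

lemma measurable_terms: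
  "(\<lambda>(x, y). pdiff g p x y) \<in> borel_measurable (borel \<Otimes>\<^sub>M borel)"
  "(\<lambda>(x, y). shift_term g G p x y) \<in> borel_measurable (borel \<Otimes>\<^sub>M borel)"
  "(\<lambda>(x, y). near_term g G p s x y) \<in> borel_measurable (borel \<Otimes>\<^sub>M borel)"
  "(\<lambda>(x, y). middle_term g G p \<epsilon> l x y) \<in> borel_measurable (borel \<Otimes>\<^sub>M borel)"
  "(\<lambda>(x, y). far_term g G p l x y) \<in> borel_measurable (borel \<Otimes>\<^sub>M borel)"
proof -
  show "(\<lambda>(x, y). pdiff g p x y) \<in> borel_measurable (borel \<Otimes>\<^sub>M borel)"
    unfolding pdiff_def by measurable
  show "(\<lambda>(x, y). shift_term g G p x y) \<in> borel_measurable (borel \<Otimes>\<^sub>M borel)"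
    unfolding shift_term_def case_prod_beta by (intro measurable_compose[OF measurable_hlmax_tdiff measurable_ennpowr]) simp_all
  show "(\<lambda>(x, y). near_term g G p s x y) \<in> borel_measurable (borel \<Otimes>\<^sub>M borel)"
    unfolding near_term_def case_prod_beta
    by (intro borel_measurable_times_ennreal measurable_compose[OF measurable_hlmax_hquot measurable_ennpowr]) simp_all
  show "(\<lambda>(x, y). middle_term g G p \<epsilon> l x y) \<in> borel_measurable (borel \<Otimes>\<^sub>M borel)"
    unfolding middle_term_def pdiff_def indicator_def by measurable
  show "(\<lambda>(x, y). far_term g G p l x y) \<in> borel_measurable (borel \<Otimes>\<^sub>M borel)"
    unfolding far_term_def case_prod_beta
  proof (intro measurable_havg_pair)
    show "(\<lambda>(v, w). ennpowr (hlmax (tdiff g G w) (fst v)) p) \<in> borel_measurable ((borel \<Otimes>\<^sub>M borel) \<Otimes>\<^sub>M borel)"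
      unfolding case_prod_beta
      by (rule measurable_compose[OF measurable_hlmax_tdiff measurable_ennpowr]) simp_all
  qed simp_all
qed

lemma energy_eq: "energy g G p s = (\<integral>\<^sup>+x. \<integral>\<^sup>+y. pdiff g p x y * skernel_on G (s * p) x y \<partial>lborel \<partial>lborel)"
  unfolding skernel_on_def
  by (rule nn_integral_cong) (auto simp: indicator_def intro!: nn_integral_cong)

lemma weighted_le:
  "(\<integral>\<^sup>+x. \<integral>\<^sup>+y. F x y * skernel_on G (s * p) x y \<partial>lborel \<partial>lborel)
    \<le> (\<integral>\<^sup>+x. \<integral>\<^sup>+y. F x y * skernel (s * p) (x - y) \<partial>lborel \<partial>lborel)"
  unfolding skernel_on_def by (intro nn_integral_mono) (auto simp: indicator_def)

text \<open>The near and middle terms are estimated with y fixed, so the order is exchanged. The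
  indicator of y must be kept, since these terms confine w but not y to G; \<open>tdiff\<close>
  confines both points, so for the shift and far terms \<open>weighted_le\<close> can drop the
  indicators.\<close>

lemma weighted_le_snd:
  assumes [measurable]: "(\<lambda>(x, y). F x y) \<in> borel_measurable (borel \<Otimes>\<^sub>M borel)"
  shows "(\<integral>\<^sup>+x. \<integral>\<^sup>+y. F x y * skernel_on G (s * p) x y \<partial>lborel \<partial>lborel)
    \<le> (\<integral>\<^sup>+y\<in>G. (\<integral>\<^sup>+x. F x y * skernel (s * p) (x - y) \<partial>lborel) \<partial>lborel)"
proof -
  note [measurable] = measurable_skernel_on[OF G]
  have m: "(\<lambda>(x, y). F x y * skernel_on G (s * p) x y) \<in> borel_measurable (lborel \<Otimes>\<^sub>M lborel)"
    by measurable
  have "(\<integral>\<^sup>+x. \<integral>\<^sup>+y. F x y * skernel_on G (s * p) x y \<partial>lborel \<partial>lborel) = (\<integral>\<^sup>+y. \<integral>\<^sup>+x. F x y * skernel_on G (s * p) x y \<partial>lborel \<partial>lborel)"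
    by (rule lborel_pair.Fubini'[OF m, symmetric])
  also have "\<dots> \<le> (\<integral>\<^sup>+y\<in>G. (\<integral>\<^sup>+x. F x y * skernel (s * p) (x - y) \<partial>lborel) \<partial>lborel)"
    unfolding skernel_on_def by (rule nn_integral_mono) (auto simp: indicator_def intro!: nn_integral_mono)
  finally show ?thesis .
qed

lemma weighted_add:
  assumes [measurable]: "(\<lambda>(x, y). F x y) \<in> borel_measurable (borel \<Otimes>\<^sub>M borel)"
    "(\<lambda>(x, y). F' x y) \<in> borel_measurable (borel \<Otimes>\<^sub>M borel)"
  shows "(\<integral>\<^sup>+x. \<integral>\<^sup>+y. (F x y + F' x y) * skernel_on G (s * p) x y \<partial>lborel \<partial>lborel)
    = (\<integral>\<^sup>+x. \<integral>\<^sup>+y. F x y * skernel_on G (s * p) x y \<partial>lborel \<partial>lborel) + (\<integral>\<^sup>+x. \<integral>\<^sup>+y. F' x y * skernel_on G (s * p) x y \<partial>lborel \<partial>lborel)"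
proof -
  note [measurable] = measurable_skernel_on[OF G]
  have "(\<integral>\<^sup>+y. (F x y + F' x y) * skernel_on G (s * p) x y \<partial>lborel)
    = (\<integral>\<^sup>+y. F x y * skernel_on G (s * p) x y \<partial>lborel) + (\<integral>\<^sup>+y. F' x y * skernel_on G (s * p) x y \<partial>lborel)" for x
    unfolding distrib_right by (rule nn_integral_add) measurable
  then show ?thesis
    by (simp only:) (rule nn_integral_add; measurable)
qed

lemma hlconst_nonneg: "0 \<le> hlconst p n"
  using p by (simp add: hlconst_def)

lemma total_term_integral_le:
  "(\<integral>\<^sup>+x. \<integral>\<^sup>+y. total_term g G p s \<epsilon> l x y * skernel_on G (s * p) x y \<partial>lborel \<partial>lborel)
    \<le> ennreal (integral_const p \<epsilon> DIM('a) * l powr (\<epsilon> + s * p)) * energy g G p s"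
    (is "_ \<le> _ * ?N")
proof -
  note [measurable] = measurable_terms
  let ?n = "DIM('a)" and ?l = "l powr (\<epsilon> + s * p)"
  let ?H = "hlconst p ?n" and ?T = "tailconst \<epsilon> ?n * 4 powr (p + 1)"
  let ?F = "tailconst ?n ?n / unit_ball_vol ?n * 2 powr p"
  let ?I = "\<lambda>F. \<integral>\<^sup>+x. \<integral>\<^sup>+y. F x y * skernel_on G (s * p) x y \<partial>lborel \<partial>lborel"
  have l1: "1 \<le> ?l" using l \<epsilon> s p by (intro ge_one_powr_ge_zero) auto
  have H: "0 \<le> ?H" by (rule hlconst_nonneg)
  have T: "0 \<le> ?T" using \<epsilon> by (simp add: tailconst_nonneg)
  have F: "0 \<le> ?F" by (simp add: tailconst_nonneg)
  have eq: "?I (total_term g G p s \<epsilon> l) = ?I (pdiff g p) + (?I (shift_term g G p) + ?I (near_term g G p s)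
      + ?I (middle_term g G p \<epsilon> l) + ?I (far_term g G p l))"
  proof -
    have sums:
      "(\<lambda>(x, y). shift_term g G p x y + near_term g G p s x y) \<in> borel_measurable (borel \<Otimes>\<^sub>M borel)"
      "(\<lambda>(x, y). shift_term g G p x y + near_term g G p s x y + middle_term g G p \<epsilon> l x y) \<in> borel_measurable (borel \<Otimes>\<^sub>M borel)"
      "(\<lambda>(x, y). shift_term g G p x y + near_term g G p s x y + middle_term g G p \<epsilon> l x y + far_term g G p l x y) \<in> borel_measurable (borel \<Otimes>\<^sub>M borel)"
      by measurable
    show ?thesis
      unfolding total_term_def weighted_add[OF measurable_terms(1) sums(3)]
        weighted_add[OF sums(2) measurable_terms(5)] weighted_add[OF sums(1) measurable_terms(4)]
        weighted_add[OF measurable_terms(2,3)] ..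
  qed
  have "?I (pdiff g p) \<le> ennreal (1 * ?l) * ?N"
    unfolding energy_eq using l1 mult_right_mono[of 1 "ennreal ?l"] by simp
  moreover have "?I (shift_term g G p) \<le> ennreal (?H * ?l) * ?N"
  proof -
    have "?I (shift_term g G p) \<le> ennreal ?H * ?N"
      by (rule order_trans[OF weighted_le shift_term_integral_le[OF g G p s]])
    also have "\<dots> \<le> ennreal (?H * ?l) * ?N"
      using H l1 mult_left_mono[OF l1 H] by (intro mult_right_mono ennreal_leI) simp_all
    finally show ?thesis .
  qed
  moreover have "?I (near_term g G p s) \<le> ennreal (?H * ?l) * ?N"
  proof -
    have "?I (near_term g G p s) \<le> ennreal ?H * ?N"
      by (rule order_trans[OF weighted_le_snd[OF measurable_terms(3)] near_term_integral_le[OF g G p s]])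
    also have "\<dots> \<le> ennreal (?H * ?l) * ?N"
      using H l1 mult_left_mono[OF l1 H] by (intro mult_right_mono ennreal_leI) simp_all
    finally show ?thesis .
  qed
  moreover have "?I (middle_term g G p \<epsilon> l) \<le> ennreal (?T * ?l) * ?N"
    by (rule order_trans[OF weighted_le_snd[OF measurable_terms(4)] middle_term_integral_le[OF g G p s \<epsilon> l]])
  moreover have "?I (far_term g G p l) \<le> ennreal (?F * ?H * ?l) * ?N"
  proof -
    have "?I (far_term g G p l) \<le> ennreal (?F * l powr (s * p)) * (ennreal ?H * ?N)"
      by (rule order_trans[OF weighted_le far_term_integral_le[OF g G p s l]])
    also have "\<dots> = ennreal (?F * l powr (s * p) * ?H) * ?N"
      by (simp only: mult.assoc[symmetric] ennreal_mult''[OF H, symmetric])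
    also have "\<dots> \<le> ennreal (?F * ?H * ?l) * ?N"
    proof (intro mult_right_mono ennreal_leI)
      have "l powr (s * p) \<le> ?l" using l \<epsilon> by (intro powr_mono) auto
      then have "(?F * ?H) * l powr (s * p) \<le> (?F * ?H) * ?l"
        by (rule mult_left_mono[OF _ mult_nonneg_nonneg[OF F H]])
      then show "?F * l powr (s * p) * ?H \<le> ?F * ?H * ?l" by (simp only: mult_ac)
    qed simp
    finally show ?thesis .
  qed
  ultimately have "?I (total_term g G p s \<epsilon> l) \<le> ennreal (1 * ?l) * ?N + (ennreal (?H * ?l) * ?N + ennreal (?H * ?l) * ?N
      + ennreal (?T * ?l) * ?N + ennreal (?F * ?H * ?l) * ?N)"
    unfolding eq by (intro add_mono)
  also have "\<dots> = ennreal (1 * ?l + (?H * ?l + ?H * ?l + ?T * ?l + ?F * ?H * ?l)) * ?N"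
    using H T F by (simp only: distrib_right[symmetric] ennreal_plus[symmetric] mult_nonneg_nonneg powr_ge_zero add_nonneg_nonneg zero_le_one)
  also have "1 * ?l + (?H * ?l + ?H * ?l + ?T * ?l + ?F * ?H * ?l) = integral_const p \<epsilon> ?n * ?l"
    by (simp add: integral_const_def algebra_simps)
  finally show ?thesis .
qed

text \<open>Each ordering of x and y controls one sign of the difference of maximal functions, so
  both are needed; the kernel is symmetric, and the reflected term only doubles the
  constant.\<close>

lemma symmetrized_integral_le:
  assumes "0 \<le> c"
  shows "(\<integral>\<^sup>+x. \<integral>\<^sup>+y. ennreal c * (total_term g G p s \<epsilon> l x y + total_term g G p s \<epsilon> l y x) * skernel_on G (s * p) x y \<partial>lborel \<partial>lborel)
    \<le> ennreal (2 * c * integral_const p \<epsilon> DIM('a) * l powr (\<epsilon> + s * p)) * energy g G p s"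
proof -
  note [measurable] = measurable_terms measurable_skernel_on[OF G]
  let ?t = "total_term g G p s \<epsilon> l"
  let ?I = "\<lambda>F. \<integral>\<^sup>+x. \<integral>\<^sup>+y. F x y * skernel_on G (s * p) x y \<partial>lborel \<partial>lborel"
  have t[measurable]: "(\<lambda>(x, y). ?t x y) \<in> borel_measurable (borel \<Otimes>\<^sub>M borel)"
    unfolding total_term_def by measurable
  have m: "(\<lambda>(x, y). ?t y x) \<in> borel_measurable (borel \<Otimes>\<^sub>M borel)"
    by measurable
  have m2: "(\<lambda>(x, y). ?t x y * skernel_on G (s * p) x y) \<in> borel_measurable (lborel \<Otimes>\<^sub>M lborel)"
    by measurable
  have [measurable]: "(\<lambda>(x, y). (?t x y + ?t y x) * skernel_on G (s * p) x y) \<in> borel_measurable (borel \<Otimes>\<^sub>M borel)"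
    by measurable
  have "?I (\<lambda>x y. ennreal c * (?t x y + ?t y x))
    = (\<integral>\<^sup>+x. ennreal c * (\<integral>\<^sup>+y. (?t x y + ?t y x) * skernel_on G (s * p) x y \<partial>lborel) \<partial>lborel)"
    unfolding mult.assoc by (intro nn_integral_cong nn_integral_cmult) measurable
  also have "\<dots> = ennreal c * ?I (\<lambda>x y. ?t x y + ?t y x)"
    by (rule nn_integral_cmult) measurable
  also have "?I (\<lambda>x y. ?t x y + ?t y x) = ?I ?t + ?I (\<lambda>x y. ?t y x)"
    by (rule weighted_add[OF t m])
  also have "?I (\<lambda>x y. ?t y x) = ?I ?t"
    using lborel_pair.Fubini'[OF m2] by (subst skernel_on_commute)
  also have "?I ?t + ?I ?t = 2 * ?I ?t" by (simp add: mult_2)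
  also have "ennreal c * (2 * ?I ?t) \<le> ennreal c * (2 * (ennreal (integral_const p \<epsilon> DIM('a) * l powr (\<epsilon> + s * p)) * energy g G p s))"
    by (intro mult_left_mono total_term_integral_le) simp_all
  also have "\<dots> = ennreal (2 * c * integral_const p \<epsilon> DIM('a) * l powr (\<epsilon> + s * p)) * energy g G p s"
  proof -
    have "ennreal (2 * c * u) = ennreal c * (2 * ennreal u)" for u
    proof -
      have "ennreal (2 * c * u) = ennreal (c * (2 * u))" by (simp add: mult_ac)
      also have "\<dots> = ennreal c * (2 * ennreal u)"
        using assms by (simp only: ennreal_mult' zero_le_numeral ennreal_numeral)
      finally show ?thesis .
    qed
    from this[of "integral_const p \<epsilon> DIM('a) * l powr (\<epsilon> + s * p)"] show ?thesis
      by (simp only: mult.assoc)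
  qed
  finally show ?thesis .
qed

end

subsection \<open>The local maximal function\<close>

text \<open>A ball centered in G that leaves G meets the frontier by connectedness, and so brings it
  closer than r to x.\<close>

lemma ball_subset_of_le_bdist:
  fixes x :: "'a::euclidean_space"
  assumes "x \<in> G" "ereal r \<le> bdist G x"
  shows "ball x r \<subseteq> G"
proof (cases "G = UNIV")
  case False
  show ?thesis
  proof (rule ccontr)
    assume "\<not> ball x r \<subseteq> G"
    then obtain z where z: "z \<in> ball x r" "z \<notin> G" by blast
    then have "dist x z < r" by simp
    with zero_le_dist[of x z] have "0 < r" by linarith
    then have "ball x r \<inter> frontier G \<noteq> {}"
      using z assms(1) connected_Int_frontier[OF connected_ball, of x r G]
      by (metis DiffI IntI centre_in_ball empty_iff)
    then obtain w where "w \<in> frontier G" "dist x w < r" by auto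
    then have "infdist x (frontier G) < r"
      using infdist_le[of w "frontier G" x] by linarith
    with assms(2) False show False by (simp add: bdist_def)
  qed
qed simp

text \<open>The Tonelli and measurability arguments run over Borel sets, whereas f is only Lebesgue
  measurable on G. Extension by 0 lets global maximal operators act on g.\<close>

lemma borel_representative:
  fixes f :: "'a::euclidean_space \<Rightarrow> real"
  assumes "open G" "f \<in> borel_measurable (lebesgue_on G)"
  obtains g where "g \<in> borel_measurable borel" "\<And>x. 0 \<le> g x" "\<And>x. x \<notin> G \<Longrightarrow> g x = 0"
    "AE x in lborel. x \<in> G \<longrightarrow> g x = \<bar>f x\<bar>"
proof -
  have "(\<lambda>x. if x \<in> G then f x else 0) \<in> borel_measurable lebesgue"
    using assms by (intro borel_measurable_if_I) auto
  then obtain h where h: "h \<in> borel_measurable lborel" "AE x in lborel. (if x \<in> G then f x else 0) = h x"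
    using completion_ex_borel_measurable_real by blast
  have [measurable]: "h \<in> borel_measurable borel" "G \<in> sets borel"
    using h assms by simp_all
  show thesis
  proof (rule that[of "\<lambda>x. \<bar>h x\<bar> * indicator G x"])
    show "AE x in lborel. x \<in> G \<longrightarrow> \<bar>h x\<bar> * indicator G x = \<bar>f x\<bar>"
      using h(2) by eventually_elim auto
  qed auto
qed

lemma ball_avg_eq_havg:
  fixes f g :: "'a::euclidean_space \<Rightarrow> real"
  assumes "AE x in lborel. x \<in> G \<longrightarrow> g x = \<bar>f x\<bar>" "0 < r" "ball x r \<subseteq> G"
  shows "ball_avg f x r = havg g x r"
proof -
  have "(\<integral>\<^sup>+y\<in>ball x r. ennreal \<bar>f y\<bar> \<partial>lborel) = (\<integral>\<^sup>+y\<in>ball x r. ennreal (g y) \<partial>lborel)"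
  proof (rule nn_integral_cong_AE)
    show "AE y in lborel. ennreal \<bar>f y\<bar> * indicator (ball x r) y = ennreal (g y) * indicator (ball x r) y"
      using assms(1) by eventually_elim (use assms(3) in \<open>auto simp: indicator_def\<close>)
  qed
  then show ?thesis
    using assms(2) by (simp add: ball_avg_def havg_def nn_integral_completion)
qed

text \<open>This is how f in L^p enters: it makes the local maximal function finite almost
  everywhere, so that the value of \<infinity> - \<infinity> is immaterial.\<close>

lemma hlmax_finite_AE:
  fixes h :: "'a::euclidean_space \<Rightarrow> ennreal"
  assumes "1 < p" and h: "h \<in> borel_measurable borel" and fin: "(\<integral>\<^sup>+x. ennpowr (h x) p \<partial>lborel) < top"
  shows "AE x in lborel. hlmax h x < top"
proof -
  have [measurable]: "hlmax h \<in> borel_measurable borel" by (rule measurable_hlmax[OF h])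
  have "(\<integral>\<^sup>+x. ennpowr (hlmax h x) p \<partial>lborel) < top"
    using hlmax_strong_type[OF assms(1) h] fin
    by (auto intro: order_le_less_trans simp: ennreal_mult_less_top)
  then have "AE x in lborel. ennpowr (hlmax h x) p \<noteq> \<infinity>"
    by (intro nn_integral_noteq_infinite) simp_all
  then show ?thesis
  proof eventually_elim
    fix x assume "ennpowr (hlmax h x) p \<noteq> \<infinity>"
    then have "hlmax h x \<noteq> top" by (metis ennpowr_top infinity_ennreal_def)
    then show "hlmax h x < top" by (simp add: less_top)
  qed
qed

lemma in_Lp_nn_integral_finite:
  fixes f g :: "'a::euclidean_space \<Rightarrow> real"
  assumes "open G" "in_Lp p G f" and g0: "\<And>x. 0 \<le> g x" "\<And>x. x \<notin> G \<Longrightarrow> g x = 0"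
    and "AE x in lborel. x \<in> G \<longrightarrow> g x = \<bar>f x\<bar>"
  shows "(\<integral>\<^sup>+x. ennpowr (ennreal (g x)) p \<partial>lborel) < top"
proof -
  have "(\<integral>\<^sup>+x. ennpowr (ennreal (g x)) p \<partial>lborel) = (\<integral>\<^sup>+x. ennreal (\<bar>f x\<bar> powr p) * indicator G x \<partial>lborel)"
  proof (rule nn_integral_cong_AE)
    show "AE x in lborel. ennpowr (ennreal (g x)) p = ennreal (\<bar>f x\<bar> powr p) * indicator G x"
      using assms(5) by eventually_elim (use g0 in \<open>auto simp: indicator_def ennpowr_ennreal\<close>)
  qed
  also have "\<dots> = (\<integral>\<^sup>+x. ennreal (\<bar>f x\<bar> powr p) \<partial>lebesgue_on G)"
    using assms(1) by (subst nn_integral_restrict_space) (auto simp: nn_integral_completion)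
  also have "\<dots> < top"
    using assms(2) unfolding in_Lp_def integrable_iff_bounded by simp
  finally show ?thesis .
qed

lemma e2ennreal_abs_diff_le:
  fixes a b :: ennreal
  assumes "a < top" "b < top" "a \<le> b + c" "b \<le> a + c'"
  shows "e2ennreal \<bar>enn2ereal a - enn2ereal b\<bar> \<le> max c c'"
proof -
  obtain u v where uv: "a = ennreal u" "0 \<le> u" "b = ennreal v" "0 \<le> v"
    using assms by (cases a; cases b) auto
  have e: "e2ennreal \<bar>enn2ereal a - enn2ereal b\<bar> = ennreal \<bar>u - v\<bar>"
    using uv by (simp add: enn2ereal_ennreal)
  have "ennreal (u - v) \<le> c" "ennreal (v - u) \<le> c'"
    using assms(3,4) uv by (cases c; cases c'; simp add: ennreal_plus[symmetric] ennreal_leI del: ennreal_plus)+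
  then show ?thesis unfolding e by (cases "v \<le> u") (auto simp: le_max_iff_disj)
qed

section \<open>Pointwise bounds for the local maximal function\<close>

context
  fixes f g :: "'a::euclidean_space \<Rightarrow> real" and G :: "'a set" and R :: "'a \<Rightarrow> real" and p s \<epsilon> L :: real
  assumes p: "1 < p" and s: "0 < s" "s < 1" and \<epsilon>: "0 < \<epsilon>" "\<epsilon> < 1" and L: "0 \<le> L"
    and G: "open G" and R: "L-lipschitz_on G R" "\<And>x. x \<in> G \<Longrightarrow> 0 \<le> R x \<and> ereal (R x) \<le> bdist G x"
    and g[measurable]: "g \<in> borel_measurable borel" and g0: "\<And>x. 0 \<le> g x"
    and fg: "AE x in lborel. x \<in> G \<longrightarrow> g x = \<bar>f x\<bar>"
begin

lemma ball_in_G: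
  assumes "x \<in> G" "r \<le> R x" shows "ball x r \<subseteq> G"
  using ball_subset_of_le_bdist[of x G "R x"] R(2)[OF assms(1)] assms subset_ball[of r "R x" x] by blast

lemma havg_le_maximal_fun:
  assumes "x \<in> G" "0 < r" "r \<le> R x"
  shows "havg g x r \<le> maximal_fun R f x"
proof -
  have "havg g x r = ball_avg f x r"
    using ball_in_G[OF assms(1,3)] assms by (intro ball_avg_eq_havg[OF fg, symmetric])
  then show ?thesis unfolding maximal_fun_def using assms by (auto intro!: SUP_upper)
qed

lemma le_maximal_fun:
  assumes "x \<in> G" "g x = \<bar>f x\<bar>"
  shows "ennreal (g x) \<le> maximal_fun R f x"
proof -
  have "ball_avg f x 0 \<le> maximal_fun R f x"
    unfolding maximal_fun_def using R(2)[OF assms(1)] by (intro SUP_upper) auto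
  then show ?thesis using assms by (simp add: ball_avg_def)
qed

lemma maximal_fun_finite:
  assumes "x \<in> G" "hlmax g x < top"
  shows "maximal_fun R f x < top"
proof -
  have "maximal_fun R f x \<le> ennreal \<bar>f x\<bar> + ennreal (2 ^ DIM('a)) * hlmax g x"
    unfolding maximal_fun_def
  proof (rule SUP_least)
    fix r assume r: "r \<in> {0..R x}"
    show "ball_avg f x r \<le> ennreal \<bar>f x\<bar> + ennreal (2 ^ DIM('a)) * hlmax g x"
    proof (cases "r = 0")
      case False
      then have "ball_avg f x r = havg g x r"
        using r ball_in_G[OF assms(1)] by (intro ball_avg_eq_havg[OF fg]) auto
      also have "\<dots> \<le> ennreal (2 ^ DIM('a)) * hlmax g x"
        using r False by (intro havg_le_hlmax) auto
      finally show ?thesis by (simp add: add_increasing)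
    qed (simp add: ball_avg_def)
  qed
  also have "\<dots> < top" using assms(2) by (simp add: ennreal_mult_less_top)
  finally show ?thesis .
qed

text \<open>The added error does not involve the radius, so bounding each average suffices.\<close>

lemma maximal_fun_le:
  assumes x: "x \<in> G" "g x = \<bar>f x\<bar>" and y: "y \<in> G" "g y = \<bar>f y\<bar>" and "x \<noteq> y"
  shows "maximal_fun R f x \<le> maximal_fun R f y
    + ennpowr (ennreal (pointwise_const p DIM('a)) * total_term g G p s \<epsilon> (1 + L) x y) (1 / p)"
    (is "_ \<le> _ + ennpowr (ennreal ?c * ?Q) _")
  unfolding maximal_fun_def[of R f x]
proof (rule SUP_least)
  fix r assume r: "r \<in> {0..R x}"
  let ?m = "maximal_fun R f y" and ?d = "dist x y"
  have root: "e \<le> ennpowr (ennreal ?c * ?Q) (1 / p)" if "ennpowr e p \<le> ennreal ?c * ?Q" for e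
  proof -
    have "ennpowr (ennpowr e p) (1 / p) \<le> ennpowr (ennreal ?c * ?Q) (1 / p)"
      using p that by (intro ennpowr_mono) auto
    then show ?thesis using p by (simp add: ennpowr_powr)
  qed
  have c1: "1 \<le> ?c" by (rule pointwise_const_bounds(5))
  show "ball_avg f x r \<le> ?m + ennpowr (ennreal ?c * ?Q) (1 / p)"
  proof (cases "r = 0")
    case True
    \<comment> \<open>Radius 0 is the case for which \<open>total_term\<close> contains
      \<open>pdiff\<close>.\<close>
    have "ennpowr (ennreal \<bar>g x - g y\<bar>) p \<le> ?Q"
      by (simp add: total_term_def pdiff_def)
    also have "\<dots> \<le> ennreal ?c * ?Q"
      using c1 mult_right_mono[of 1 "ennreal ?c" ?Q] by simp
    finally have "ennreal \<bar>g x - g y\<bar> \<le> ennpowr (ennreal ?c * ?Q) (1 / p)" by (rule root)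
    moreover have "ball_avg f x r \<le> ennreal (g y) + ennreal \<bar>g x - g y\<bar>"
      using True x g0[of y] by (simp add: ball_avg_def ennreal_leI flip: ennreal_plus)
    moreover have "ennreal (g y) \<le> ?m" by (rule le_maximal_fun[OF y])
    ultimately show ?thesis by (meson add_mono order_trans)
  next
    case False
    then have r0: "0 < r" "r \<le> R x" using r by auto
    have "\<bar>R x - R y\<bar> \<le> L * ?d"
      using lipschitz_onD[OF R(1) x(1) y(1)] by (simp add: dist_real_def)
    moreover have "(1 + L) * ?d = ?d + L * ?d" by (simp add: distrib_right)
    \<comment> \<open>The Lipschitz condition alone gives r - L * d <= R y; the extra d ensures l >=
      1 even if L = 0.\<close>
    ultimately have Ry: "r - (1 + L) * ?d \<le> R y"
      using r0 zero_le_dist[of x y] by linarith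
    have "\<exists>e. havg g x r \<le> ?m + e \<and> ennpowr e p \<le> ennreal ?c *
      (shift_term g G p x y + near_term g G p s x y + middle_term g G p \<epsilon> (1 + L) x y + far_term g G p (1 + L) x y)"
    proof (rule havg_comparison[OF g g0 _ p s \<epsilon> _ \<open>x \<noteq> y\<close> r0(1) ball_in_G[OF x(1) r0(2)] le_maximal_fun[OF y]])
      show "ball y (r - (1 + L) * ?d) \<subseteq> G \<and> havg g y (r - (1 + L) * ?d) \<le> ?m"
        if "0 < r - (1 + L) * ?d"
        using ball_in_G[OF y(1) Ry] havg_le_maximal_fun[OF y(1) that Ry] by simp
    qed (use G L in auto)
    then obtain e where e: "havg g x r \<le> ?m + e" "ennpowr e p \<le> ennreal ?c *
      (shift_term g G p x y + near_term g G p s x y + middle_term g G p \<epsilon> (1 + L) x y + far_term g G p (1 + L) x y)"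
      by blast
    note e(2)
    also have "\<dots> \<le> ennreal ?c * ?Q"
      by (intro mult_left_mono) (simp_all add: total_term_def)
    finally have "e \<le> ennpowr (ennreal ?c * ?Q) (1 / p)" by (rule root)
    moreover have "ball_avg f x r = havg g x r"
      using ball_in_G[OF x(1) r0(2)] r0 by (intro ball_avg_eq_havg[OF fg])
    ultimately show ?thesis using e(1) by (metis add_left_mono order_trans)
  qed
qed

lemma maximal_fun_diff_le:
  assumes x: "x \<in> G" "g x = \<bar>f x\<bar>" "hlmax g x < top" and y: "y \<in> G" "g y = \<bar>f y\<bar>" "hlmax g y < top"
    and "x \<noteq> y"
  shows "ennpowr (e2ennreal \<bar>enn2ereal (maximal_fun R f x) - enn2ereal (maximal_fun R f y)\<bar>) p
      / ennreal (norm (x - y) powr (real DIM('a) + s * p))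
    \<le> ennreal (pointwise_const p DIM('a)) * (total_term g G p s \<epsilon> (1 + L) x y + total_term g G p s \<epsilon> (1 + L) y x)
      * skernel (s * p) (x - y)"
proof -
  let ?c = "ennreal (pointwise_const p DIM('a))" and ?t = "total_term g G p s \<epsilon> (1 + L)"
  have "ennpowr (e2ennreal \<bar>enn2ereal (maximal_fun R f x) - enn2ereal (maximal_fun R f y)\<bar>) p
    \<le> ennpowr (max (ennpowr (?c * ?t x y) (1 / p)) (ennpowr (?c * ?t y x) (1 / p))) p"
    using p assms by (intro ennpowr_mono e2ennreal_abs_diff_le maximal_fun_finite maximal_fun_le) auto
  also have "\<dots> \<le> ?c * (?t x y + ?t y x)"
    using p by (simp add: max_def ennpowr_powr distrib_left add_increasing add_increasing2)
  finally have *: "ennpowr (e2ennreal \<bar>enn2ereal (maximal_fun R f x) - enn2ereal (maximal_fun R f y)\<bar>) p \<le> ?c * (?t x y + ?t y x)" .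
  \<comment> \<open>Valid only off the diagonal, where \<open>skernel\<close> is 0 but the
    reciprocal is infinite.\<close>
  have "inverse (ennreal (norm (x - y) powr (real DIM('a) + s * p))) = skernel (s * p) (x - y)"
    using \<open>x \<noteq> y\<close> unfolding skernel_def by (subst inverse_ennreal) (simp_all only: powr_minus, simp)
  then show ?thesis
    unfolding divide_ennreal_def using * by (simp add: mult_right_mono)
qed

end

section \<open>From pointwise bounds to the seminorm inequality\<close>

theorem frac_sobolev_maximal_fun_le:
  fixes f :: "'a::euclidean_space \<Rightarrow> real" and G :: "'a set" and R :: "'a \<Rightarrow> real" and p s \<epsilon> L :: real
  assumes p: "1 < p" and s: "0 < s" "s < 1" and \<epsilon>: "0 < \<epsilon>" "\<epsilon> < 1" and L: "0 \<le> L"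
    and G: "open G" and R: "L-lipschitz_on G R" "\<And>x. x \<in> G \<Longrightarrow> 0 \<le> R x \<and> ereal (R x) \<le> bdist G x"
    and f: "in_Lp p G f"
  shows "frac_sobolev_seminorm s p G (\<lambda>x. enn2ereal (maximal_fun R f x))
    \<le> ennreal ((2 * pointwise_const p DIM('a) * integral_const p \<epsilon> DIM('a)) powr (1 / p) * (1 + L) powr (\<epsilon> / p + s)) *
      frac_sobolev_seminorm s p G (\<lambda>x. ereal (f x))"
proof -
  let ?n = "DIM('a)" and ?l = "1 + L"
  let ?c = "pointwise_const p ?n" and ?T = "integral_const p \<epsilon> ?n"
  have [measurable]: "G \<in> sets borel" using G by simp
  obtain g where g[measurable]: "g \<in> borel_measurable borel" and g0: "\<And>x. 0 \<le> g x" "\<And>x. x \<notin> G \<Longrightarrow> g x = 0"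
    and fg: "AE x in lborel. x \<in> G \<longrightarrow> g x = \<bar>f x\<bar>"
    using borel_representative[OF G] f unfolding in_Lp_def by blast
  have l: "1 \<le> ?l" using L by simp
  have c0: "0 \<le> ?c" using pointwise_const_bounds(5)[of p ?n] by linarith
  have T0: "0 \<le> ?T"
    using p \<epsilon> by (simp add: integral_const_def hlconst_def tailconst_nonneg add_nonneg_nonneg)
  \<comment> \<open>The good points: g represents |f| there and the maximal function is finite.
    Almost every pair consists of two of them.\<close>
  define P where "P x \<longleftrightarrow> (x \<in> G \<longrightarrow> g x = \<bar>f x\<bar>) \<and> hlmax g x < top" for x
  have P: "AE x in lborel. P x"
  proof -
    have "AE x in lborel. hlmax g x < top"
      by (rule hlmax_finite_AE[OF p _ in_Lp_nn_integral_finite[OF G f g0 fg]]) measurable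
    with fg show ?thesis unfolding P_def by eventually_elim simp
  qed
  let ?M = "\<lambda>x. enn2ereal (maximal_fun R f x)"
  let ?K = "\<lambda>u x y. ennpowr (e2ennreal \<bar>u x - u y\<bar>) p / ennreal (norm (x - y) powr (real ?n + s * p))"
  let ?I = "\<lambda>u. \<integral>\<^sup>+x\<in>G. (\<integral>\<^sup>+y\<in>G. ?K u x y \<partial>lebesgue) \<partial>lebesgue"
  let ?S = "\<lambda>x y. ennreal ?c * (total_term g G p s \<epsilon> ?l x y + total_term g G p s \<epsilon> ?l y x)"
  \<comment> \<open>\<open>nn_integral_completion\<close> requires no measurability, so it applies
    to the maximal function as well.\<close>
  have "?I ?M = (\<integral>\<^sup>+x. \<integral>\<^sup>+y. ?K ?M x y * indicator G y * indicator G x \<partial>lborel \<partial>lborel)"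
    unfolding nn_integral_completion by (rule nn_integral_cong) (auto simp: indicator_def)
  also have "\<dots> \<le> (\<integral>\<^sup>+x. \<integral>\<^sup>+y. ?S x y * skernel_on G (s * p) x y \<partial>lborel \<partial>lborel)"
  proof (rule nn_integral_mono_AE)
    show "AE x in lborel. (\<integral>\<^sup>+y. ?K ?M x y * indicator G y * indicator G x \<partial>lborel) \<le> (\<integral>\<^sup>+y. ?S x y * skernel_on G (s * p) x y \<partial>lborel)"
      using P
    proof eventually_elim
      fix x assume Px: "P x"
      show "(\<integral>\<^sup>+y. ?K ?M x y * indicator G y * indicator G x \<partial>lborel) \<le> (\<integral>\<^sup>+y. ?S x y * skernel_on G (s * p) x y \<partial>lborel)"
      proof (rule nn_integral_mono_AE)
        show "AE y in lborel. ?K ?M x y * indicator G y * indicator G x \<le> ?S x y * skernel_on G (s * p) x y"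
          using P AE_lborel_singleton[of x]
        proof eventually_elim
          fix y assume "P y" "y \<noteq> x"
          show "?K ?M x y * indicator G y * indicator G x \<le> ?S x y * skernel_on G (s * p) x y"
          proof (cases "x \<in> G \<and> y \<in> G")
            case True
            have "?K ?M x y \<le> ?S x y * skernel (s * p) (x - y)"
              using True Px \<open>P y\<close> \<open>y \<noteq> x\<close> unfolding P_def
              by (intro maximal_fun_diff_le[OF p s \<epsilon> L G R g g0(1) fg]) auto
            then show ?thesis using True by (simp add: skernel_on_def)
          qed (auto simp: indicator_def)
        qed
      qed
    qed
  qed
  also have "\<dots> \<le> ennreal (2 * ?c * ?T * ?l powr (\<epsilon> + s * p)) * energy g G p s"
    by (rule symmetrized_integral_le[OF g _ p s \<epsilon> l c0]) simp
  \<comment> \<open>Passing from |f| to f can only increase the differences, by the reverse triangle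
    inequality.\<close>
  also have "energy g G p s \<le> ?I (\<lambda>x. ereal (f x))"
    unfolding nn_integral_completion
  proof (rule nn_integral_mono_AE)
    show "AE x in lborel. (\<integral>\<^sup>+y\<in>G. pdiff g p x y * skernel (s * p) (x - y) \<partial>lborel) * indicator G x
      \<le> (\<integral>\<^sup>+y\<in>G. ?K (\<lambda>x. ereal (f x)) x y \<partial>lborel) * indicator G x"
      using P
    proof eventually_elim
      fix x assume Px: "P x"
      have "(\<integral>\<^sup>+y\<in>G. pdiff g p x y * skernel (s * p) (x - y) \<partial>lborel) \<le> (\<integral>\<^sup>+y\<in>G. ?K (\<lambda>x. ereal (f x)) x y \<partial>lborel)"
        if x: "x \<in> G"
      proof (rule nn_integral_mono_AE)
        show "AE y in lborel. pdiff g p x y * skernel (s * p) (x - y) * indicator G y \<le> ?K (\<lambda>x. ereal (f x)) x y * indicator G y"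
          using P AE_lborel_singleton[of x]
        proof eventually_elim
          fix y assume Py: "P y" "y \<noteq> x"
          show "pdiff g p x y * skernel (s * p) (x - y) * indicator G y \<le> ?K (\<lambda>x. ereal (f x)) x y * indicator G y"
          proof (cases "y \<in> G")
            case True
            have "\<bar>g x - g y\<bar> \<le> \<bar>f x - f y\<bar>" using Px Py x True by (simp add: P_def)
            then have "pdiff g p x y \<le> ennpowr (e2ennreal \<bar>ereal (f x) - ereal (f y)\<bar>) p"
              unfolding pdiff_def using p by (intro ennpowr_mono) (auto intro: ennreal_leI)
            moreover have "inverse (ennreal (norm (x - y) powr (real ?n + s * p))) = skernel (s * p) (x - y)"
              using Py(2) unfolding skernel_def by (subst inverse_ennreal) (simp_all only: powr_minus, simp)
            ultimately show ?thesis
              using True by (simp add: divide_ennreal_def mult_right_mono)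
          qed simp
        qed
      qed
      then show "(\<integral>\<^sup>+y\<in>G. pdiff g p x y * skernel (s * p) (x - y) \<partial>lborel) * indicator G x
        \<le> (\<integral>\<^sup>+y\<in>G. ?K (\<lambda>x. ereal (f x)) x y \<partial>lborel) * indicator G x"
        by (cases "x \<in> G") simp_all
    qed
  qed
  finally have "?I ?M \<le> ennreal (2 * ?c * ?T * ?l powr (\<epsilon> + s * p)) * ?I (\<lambda>x. ereal (f x))"
    by (simp add: mult_left_mono)
  then have "ennpowr (?I ?M) (1 / p) \<le> ennpowr (ennreal (2 * ?c * ?T * ?l powr (\<epsilon> + s * p)) * ?I (\<lambda>x. ereal (f x))) (1 / p)"
    using p by (intro ennpowr_mono) auto
  also have "\<dots> = ennreal ((2 * ?c * ?T * ?l powr (\<epsilon> + s * p)) powr (1 / p)) * ennpowr (?I (\<lambda>x. ereal (f x))) (1 / p)"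
    using c0 T0 by (simp add: ennpowr_mult ennpowr_ennreal)
  \<comment> \<open>The p-th root turns the exponent \<epsilon> + s*p into \<epsilon>/p + s.\<close>
  also have "(2 * ?c * ?T * ?l powr (\<epsilon> + s * p)) powr (1 / p) = (2 * ?c * ?T) powr (1 / p) * ?l powr (\<epsilon> / p + s)"
    using p c0 T0 l by (simp add: powr_mult powr_powr add_divide_distrib)
  finally show ?thesis
    unfolding frac_sobolev_seminorm_def .
qed

theorem corollary5p5:
  fixes p \<epsilon> :: real
  assumes "1 < p" and "0 < \<epsilon>" and "\<epsilon> < 1"
  shows "\<exists>C::real. C > 0 \<and>
    (\<forall>(G::(real ^ 'n) set) (s::real) (L::real) (R::real ^ 'n \<Rightarrow> real) (f::real ^ 'n \<Rightarrow> real).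
       open G \<longrightarrow> G \<noteq> {} \<longrightarrow> 0 < s \<longrightarrow> s < 1 \<longrightarrow> 0 \<le> L \<longrightarrow> L-lipschitz_on G R \<longrightarrow>
       (\<forall>x\<in>G. 0 \<le> R x \<and> ereal (R x) \<le> bdist G x) \<longrightarrow> in_Lp p G f \<longrightarrow>
       frac_sobolev_seminorm s p G (\<lambda>x. enn2ereal (maximal_fun R f x))
         \<le> ennreal (C * (1 + L) powr (\<epsilon> / p + s)) *
           frac_sobolev_seminorm s p G (\<lambda>x. ereal (f x)))"
proof -
  let ?n = "DIM(real ^ 'n)"
  let ?C = "(2 * pointwise_const p ?n * integral_const p \<epsilon> ?n) powr (1 / p)"
  have "1 \<le> integral_const p \<epsilon> ?n"
    using assms by (simp add: integral_const_def hlconst_def tailconst_nonneg add_increasing2)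
  then have "0 < ?C" using pointwise_const_bounds(5)[of p ?n] by simp
  moreover have "frac_sobolev_seminorm s p G (\<lambda>x. enn2ereal (maximal_fun R f x))
         \<le> ennreal (?C * (1 + L) powr (\<epsilon> / p + s)) * frac_sobolev_seminorm s p G (\<lambda>x. ereal (f x))"
    if "open G" "0 < s" "s < 1" "0 \<le> L" "L-lipschitz_on G R"
      "\<forall>x\<in>G. 0 \<le> R x \<and> ereal (R x) \<le> bdist G x" "in_Lp p G f"
    for G :: "(real ^ 'n) set" and s L :: real and R f :: "real ^ 'n \<Rightarrow> real"
    using that assms by (intro frac_sobolev_maximal_fun_le) auto
  ultimately show ?thesis by (intro exI[of _ ?C]) blast
qed

end
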